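(* Let $0<\beta<\alpha<1$ and $b_1,b_2\in\mathbb{R}$. Let $f:[0,\infty)\times\mathbb{R}^2\to\mathbb{R}$ be such that $f(\cdot,v(\cdot),w(\cdot))\in C_{1-\alpha}[0,\infty)$ for every $v,w\in AC[0,\infty)$. Suppose there are functions $F_1,F_2\in M$, with associated continuous functions $N_1,N_2:[0,\infty)\to\mathbb{R}$ respectively, such that $$|f(\tau,u,v)|\le F_1(\tau,|u|)+F_2(\tau,\tau^\beta|v|)\quad\text{for all }\tau>0,\ u,v\in\mathbb{R},$$ and $$\int_0^\infty s^\alpha N_i(s)\,ds<\infty,\qquad \int_0^\infty F_i(s,|b_1|)\,ds<\infty,\qquad i=1,2.$$ Then for every solution $x\in C^{\alpha,1}_{1-\alpha}[0,\infty)$ of the problem $$\left({}^C\mathfrak{D}_0^{\alpha}x\right)'(\tau)=f\left(\tau,x(\tau),{}^C\mathfrak{D}_0^\beta x(\tau)\right),\quad\tau>0,\qquad {}^C\mathfrak{D}_0^\alpha x(\tau)\big|_{\tau=0}=b_2,\qquad x(0)=b_1,$$ there exists $a\in\mathbb{R}$ such that $$\lim_{\tau\to\infty}\frac{x(\tau)}{\tau^\alpha}=a .$$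
   Context: $AC[0,\infty)$ denotes the functions $x:[0,\infty)\to\mathbb{R}$ that are absolutely continuous on every compact interval $[0,T]$. For $0\le\eta<1$, $C_\eta[0,\infty)$ is the set of functions $h$ such that $\tau\mapsto \tau^\eta h(\tau)$ is continuous on $[0,\infty)$ (i.e. is continuous on $(0,\infty)$ and extends continuously to $0$). For $\mu>0$ the Riemann-Liouville fractional integral is $\mathfrak{I}_0^\mu g(\tau)=\frac{1}{\Gamma(\mu)}\int_0^\tau (\tau-s)^{\mu-1}g(s)\,ds$, $\tau>0$. For $0<\alpha<1$ the Caputo fractional derivative is ${}^C\mathfrak{D}_0^\alpha x(\tau)=\mathfrak{I}_0^{1-\alpha}x'(\tau)$, $\tau>0$ (and likewise for $\beta$); its value at $\tau=0$ is understood as the limit as $\tau\to0^+$. $C^{\alpha,1}_{1-\alpha}[0,\infty)=\{x\in AC[0,\infty): ({}^C\mathfrak{D}_0^\alpha x)'\in C_{1-\alpha}[0,\infty)\}$. With $\mathbb{R}_+=[0,\infty)$, $M$ is the class of functions $F:(0,\infty)\times\mathbb{R}_+\to\mathbb{R}_+$ for which there is a continuous function $H$ on $\mathbb{R}_+$ such that $0\le F(\tau,s)-F(\tau,r)\le H(\tau)(s-r)$ for all $s\ge r\ge0$ and $\tau>0$. Such an $H$ is called the function associated with $F$; $N_i$ denotes one associated with $F_i$. *)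

theory Defs
  imports "HOL-Analysis.Analysis"
begin

text \<open>
  Functions on \<open>[0,\<infinity>)\<close> are total functions on the reals; only their values on
  \<open>[0,\<infinity>)\<close> (or \<open>(0,\<infinity>)\<close>) are ever constrained or used.
\<close>

text \<open>
  The \<open>\<epsilon>\<close>-\<open>\<delta>\<close> definition. The finite families of non-overlapping
  closed subintervals of \<open>[a,b]\<close> are the sets \<open>d\<close> with \<open>d division_of \<Union>d\<close>, and
  \<open>Inf K\<close>, \<open>Sup K\<close> are the endpoints of \<open>K \<in> d\<close>.
\<close>

definition abs_continuous_on_interval :: "real \<Rightarrow> real \<Rightarrow> (real \<Rightarrow> real) \<Rightarrow> bool" where
  "abs_continuous_on_interval a b x \<longleftrightarrow>
     (\<forall>\<epsilon>>0. \<exists>\<delta>>0. \<forall>d. d division_of \<Union>d \<and> \<Union>d \<subseteq> {a..b} \<and>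
        (\<Sum>K\<in>d. Sup K - Inf K) < \<delta> \<longrightarrow> (\<Sum>K\<in>d. \<bar>x (Sup K) - x (Inf K)\<bar>) < \<epsilon>)"

definition AC_halfline :: "(real \<Rightarrow> real) set" where
  "AC_halfline = {x. \<forall>T>0. abs_continuous_on_interval 0 T x}"

definition C_weighted :: "real \<Rightarrow> (real \<Rightarrow> real) set" where
  "C_weighted \<eta> = {h. continuous_on {0<..} (\<lambda>\<tau>. \<tau> powr \<eta> * h \<tau>) \<and>
     (\<exists>L. ((\<lambda>\<tau>. \<tau> powr \<eta> * h \<tau>) \<longlongrightarrow> L) (at_right 0))}"

definition RL_integral :: "real \<Rightarrow> (real \<Rightarrow> real) \<Rightarrow> real \<Rightarrow> real" where
  "RL_integral \<mu> g \<tau> =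
     1 / Gamma \<mu> * (LINT s:{0..\<tau>}|lebesgue. (\<tau> - s) powr (\<mu> - 1) * g s)"

text \<open>
  For \<open>x\<close> absolutely continuous, \<open>x'\<close> exists almost everywhere; the value of
  \<open>deriv x\<close> on the exceptional null set is irrelevant to the Lebesgue integral.
\<close>

definition caputo :: "real \<Rightarrow> (real \<Rightarrow> real) \<Rightarrow> real \<Rightarrow> real" where
  "caputo \<alpha> x = RL_integral (1 - \<alpha>) (deriv x)"

text \<open>
  The convergence of the integrals defining \<open>caputo \<alpha> x \<tau>\<close> is not a separate
  clause in the next definition. For \<open>x\<close> in \<open>AC_halfline\<close> they converge for almost
  every \<open>\<tau>\<close>. If \<open>caputo \<alpha> x\<close> is moreover \<open>C\<^sup>1\<close> on \<open>(0,\<infinity>)\<close> with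
  derivative \<open>y \<in> C_weighted (1 - \<alpha>)\<close>, then inverting the fractional integral gives
  \<open>x' = c * \<tau>\<^sup>\<alpha>\<^sup>-\<^sup>1 + RL_integral \<alpha> y\<close> almost everywhere with a
  constant \<open>c\<close>, whence they converge for every \<open>\<tau> > 0\<close>, and so do those defining
  \<open>caputo \<beta> x \<tau>\<close> for \<open>0 < \<beta> < \<alpha>\<close>. The default value of a
  divergent integral therefore never enters.
\<close>

definition C_caputo :: "real \<Rightarrow> (real \<Rightarrow> real) set" where
  "C_caputo \<alpha> = {x \<in> AC_halfline.
     (\<forall>\<tau>>0. caputo \<alpha> x differentiable at \<tau>) \<and>
     deriv (caputo \<alpha> x) \<in> C_weighted (1 - \<alpha>)}"

definition associated_function :: "(real \<Rightarrow> real \<Rightarrow> real) \<Rightarrow> (real \<Rightarrow> real) \<Rightarrow> bool" where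
  "associated_function F H \<longleftrightarrow> continuous_on {0..} H \<and>
     (\<forall>\<tau>>0. \<forall>r\<ge>0. \<forall>s\<ge>r. 0 \<le> F \<tau> s - F \<tau> r \<and> F \<tau> s - F \<tau> r \<le> H \<tau> * (s - r))"

definition class_M :: "(real \<Rightarrow> real \<Rightarrow> real) set" where
  "class_M = {F. (\<forall>\<tau>>0. \<forall>s\<ge>0. 0 \<le> F \<tau> s) \<and> (\<exists>H. associated_function F H)}"

end

theory Submission
  imports Defs
begin

text \<open>
  Write \<open>D\<close> for the Caputo derivative of order \<open>\<alpha>\<close> of a solution \<open>x\<close>, and \<open>y\<close> for the derivative
  of \<open>D\<close>, that is, for the right-hand side of the equation along \<open>x\<close>. Everything follows from
  \<open>\<integral>\<^sub>0\<^sup>\<infinity> \<bar>y\<bar> < \<infinity>\<close>. Indeed, \<open>D \<tau> = b\<^sub>2 + \<integral>\<^sub>0\<^sup>\<tau> y\<close> then has a limit \<open>L\<close> at infinity, and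
  \<open>x = b\<^sub>1 + RL_integral \<alpha> D\<close> inherits it: the substitution \<open>s = \<tau> u\<close> turns
  \<open>RL_integral \<alpha> D \<tau> / \<tau>\<^sup>\<alpha>\<close> into a weighted integral of \<open>D (\<tau> u)\<close> over \<open>u \<in> [0,1]\<close>, which
  tends to \<open>L / \<Gamma>(\<alpha> + 1)\<close> by dominated convergence (\<open>RL_integral_asymptotic\<close>).

  Integrability of \<open>y\<close> comes from a linear integral inequality. Both \<open>x - b\<^sub>1\<close> and, wherever
  the integral defining it converges, the Caputo derivative of order \<open>\<beta>\<close> are fractional integrals of \<open>D\<close>, of orders \<open>\<alpha>\<close> and \<open>\<alpha> - \<beta>\<close>, by the
  semigroup law \<open>RL_integral \<mu> (RL_integral \<nu> g) = RL_integral (\<mu> + \<nu>) g\<close>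
  (\<open>RL_integral_semigroup\<close>). With \<open>W \<tau> = \<bar>b\<^sub>2\<bar> + \<integral>\<^sub>0\<^sup>\<tau> \<bar>y\<bar>\<close>, a nondecreasing bound of \<open>\<bar>D\<bar>\<close>, this gives
  \<open>\<bar>x \<tau>\<bar> \<le> \<bar>b\<^sub>1\<bar> + c\<^sub>1 \<tau>\<^sup>\<alpha> W \<tau>\<close>, and \<open>\<tau>\<^sup>\<beta>\<close> times the Caputo derivative of order \<open>\<beta>\<close> is at most
  \<open>c\<^sub>2 \<tau>\<^sup>\<alpha> W \<tau>\<close> in absolute value. The growth condition then reads \<open>\<bar>y\<bar> \<le> P + K W\<close> with
  \<open>P = F\<^sub>1(\<cdot>,\<bar>b\<^sub>1\<bar>) + F\<^sub>2(\<cdot>,\<bar>b\<^sub>1\<bar>)\<close> and \<open>K s = s\<^sup>\<alpha> (c\<^sub>1 N\<^sub>1 s + c\<^sub>2 N\<^sub>2 s)\<close> integrable. Beyond a point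
  after which the integral of \<open>K\<close> is less than \<open>1/2\<close>, half of \<open>W\<close> is absorbed into the left-hand side, so \<open>W\<close>
  is bounded (\<open>integrable_if_integral_inequality\<close>).

  The analytic input is that an absolutely continuous \<open>x\<close> is recovered from \<open>deriv x\<close>:
  \<open>x \<tau> = x 0 + \<integral>\<^sub>0\<^sup>\<tau> x'\<close> as a Lebesgue integral (\<open>abs_continuous_FTC\<close>). An absolutely continuous
  function has bounded variation, hence is a difference of monotone functions, and monotone functions are
  differentiable almost everywhere by a Vitali covering argument
  (\<open>mono_on_imp_differentiable_AE\<close>). A gauge argument then integrates the derivative: the
  increments of \<open>x\<close> over intervals tagged in the exceptional null set are small by absolute
  continuity.
\<close>

section \<open>Differentiability of monotone functions\<close>

lemma division_telescope:
  fixes f :: "real \<Rightarrow> real"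
  assumes d: "d division_of {a..b}" and ab: "a \<le> b"
  shows "(\<Sum>K\<in>d. f (Sup K) - f (Inf K)) = f b - f a"
proof -
  let ?p = "(\<lambda>K. (Inf K, K)) ` d"
  have K: "\<exists>u v. K = {u..v} \<and> u \<le> v" if "K \<in> d" for K
    using division_ofD(3,4)[OF d that] by auto
  have "?p tagged_division_of {a..b}"
  proof (rule tagged_division_ofI)
    show "finite ?p" using d by auto
    fix x K assume "(x, K) \<in> ?p"
    then have x: "x = Inf K" "K \<in> d" by auto
    then show "x \<in> K" using K[OF x(2)] by auto
    show "K \<subseteq> {a..b}" using d x by blast
    show "\<exists>a b. K = cbox a b" using d x by blast
  next
    fix x1 K1 x2 K2
    assume "(x1, K1) \<in> ?p" "(x2, K2) \<in> ?p" "(x1, K1) \<noteq> (x2, K2)"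
    then have "K1 \<in> d" "K2 \<in> d" "K1 \<noteq> K2" by auto
    then show "interior K1 \<inter> interior K2 = {}" by (rule division_ofD(5)[OF d])
  next
    have "{K. \<exists>x. (x, K) \<in> ?p} = d" by auto
    then show "\<Union> {K. \<exists>x. (x, K) \<in> ?p} = {a..b}"
      using division_ofD(6)[OF d] by simp
  qed
  from additive_tagged_division_1[OF ab this, of f]
  show ?thesis
    by (subst (asm) sum.reindex) (auto simp: inj_on_def o_def)
qed

text \<open>
  A division of a part of the interval extends to a division of the whole interval. The increments
  over the latter telescope, and those that were added are nonnegative.
\<close>

lemma sum_increments_le:
  fixes f :: "real \<Rightarrow> real"
  assumes f: "mono_on {a..b} f" and d: "d division_of \<Union>d" "\<Union>d \<subseteq> {a..b}" and ab: "a \<le> b"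
  shows "(\<Sum>K\<in>d. f (Sup K) - f (Inf K)) \<le> f b - f a"
proof -
  obtain q where q: "d \<subseteq> q" "q division_of {a..b}"
    using partial_division_extend_interval[of d a b] d by auto
  have "(\<Sum>K\<in>d. f (Sup K) - f (Inf K)) \<le> (\<Sum>K\<in>q. f (Sup K) - f (Inf K))"
  proof (rule sum_mono2)
    show "finite q" using q by auto
    fix K assume "K \<in> q - d"
    then obtain u v where "K = {u..v}" "u \<le> v" "{u..v} \<subseteq> {a..b}"
      using division_ofD(2,3,4)[OF q(2), of K] by fastforce
    then show "0 \<le> f (Sup K) - f (Inf K)"
      using f by (auto simp: mono_on_def)
  qed (use q in auto)
  also have "\<dots> = f b - f a" by (rule division_telescope[OF q(2) ab])
  finally show ?thesis .
qed

text \<open>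
  In dimension one the balls of the Vitali theorem are intervals that contain the point in an arbitrary
  position, possibly as an endpoint. This is the form in which difference quotients supply covers.
\<close>

lemma Vitali_covering_intervals:
  fixes E :: "real set" and J :: "(real \<times> real) set"
  assumes J: "\<And>u v. (u, v) \<in> J \<Longrightarrow> u < v"
    and E: "\<And>t d. t \<in> E \<Longrightarrow> 0 < d \<Longrightarrow> \<exists>u v. (u, v) \<in> J \<and> t \<in> {u..v} \<and> v - u < d"
  obtains C where "countable C" "C \<subseteq> J" "disjoint_family_on (\<lambda>(u, v). {u..v}) C"
    "negligible (E - (\<Union>(u, v)\<in>C. {u..v}))"
proof -
  let ?c = "\<lambda>i::real \<times> real. (fst i + snd i) / 2" and ?r = "\<lambda>i::real \<times> real. (snd i - fst i) / 2"
  have ball: "cball (?c i) (?r i) = (case i of (u, v) \<Rightarrow> {u..v})" for i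
    by (cases i) (auto simp: cball_eq_atLeastAtMost field_simps)
  have "\<exists>i. i \<in> J \<and> t \<in> cball (?c i) (?r i) \<and> ?r i < d" if t: "t \<in> E" "0 < d" for t d
  proof -
    obtain u v where "(u, v) \<in> J" "t \<in> {u..v}" "v - u < d" using E[OF t] by blast
    then have "(u, v) \<in> J \<and> t \<in> cball (?c (u, v)) (?r (u, v)) \<and> ?r (u, v) < d"
      using t unfolding ball by auto
    then show ?thesis by blast
  qed
  note S = this
  have r: "0 < ?r i" if "i \<in> J" for i using J[of "fst i" "snd i"] that by auto
  obtain C where C: "countable C" "C \<subseteq> J"
      "pairwise (\<lambda>i j. disjnt (cball (?c i) (?r i)) (cball (?c j) (?r j))) C"
      "negligible (E - (\<Union>i\<in>C. cball (?c i) (?r i)))"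
    by (rule Vitali_covering_theorem_cballs[of J ?r E ?c, OF r S])
  have "disjoint_family_on (\<lambda>(u, v). {u..v}) C"
    using C(3) unfolding ball by (auto simp: disjoint_family_on_def pairwise_def disjnt_def)
  then show ?thesis using C that unfolding ball by blast
qed

text \<open>
  The steep intervals form a Vitali cover of \<open>E\<close>. A disjoint subfamily covers almost all of \<open>E\<close>; each
  member is shorter than \<open>1 / q\<close> times its increment, and the increments of a monotone function over
  disjoint intervals add up to at most \<open>f b - f a\<close>. The outer measure avoids a discussion of the
  measurability of \<open>E\<close>.
\<close>

lemma outer_measure_steep_le:
  fixes f :: "real \<Rightarrow> real"
  assumes f: "mono_on {a..b} f" and ab: "a \<le> b" and q: "0 < q"
    and E: "\<And>t d. t \<in> E \<Longrightarrow> 0 < d \<Longrightarrow>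
       \<exists>u v. u < v \<and> {u..v} \<subseteq> {a..b} \<and> t \<in> {u..v} \<and> v - u < d \<and> q * (v - u) < f v - f u"
  shows "outer_measure_of lebesgue E \<le> ennreal ((f b - f a) / q)"
proof -
  define J where "J = {(u, v). u < v \<and> {u..v} \<subseteq> {a..b} \<and> q * (v - u) < f v - f u}"
  obtain C where C: "countable C" "C \<subseteq> J" "disjoint_family_on (\<lambda>(u, v). {u..v}) C"
      "negligible (E - (\<Union>(u, v)\<in>C. {u..v}))"
  proof (rule Vitali_covering_intervals[of J E])
    show "\<exists>u v. (u, v) \<in> J \<and> t \<in> {u..v} \<and> v - u < d" if "t \<in> E" "0 < d" for t d
      using E[OF that] by (auto simp: J_def)
  qed (auto simp: J_def)
  let ?I = "\<lambda>(u, v). {u..v::real}"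
  have fin: "measure lebesgue (\<Union>(?I ` F)) \<le> (f b - f a) / q" if F: "F \<subseteq> C" "finite F" for F
  proof -
    have FJ: "u < v" "{u..v} \<subseteq> {a..b}" "q * (v - u) < f v - f u" if "(u, v) \<in> F" for u v
      using that F C(2) by (auto simp: J_def)
    have inj: "inj_on ?I F"
      by (rule inj_onI) (auto dest!: FJ(1) simp: atLeastatMost_subset_iff set_eq_subset split: prod.splits)
    have div: "?I ` F division_of \<Union>(?I ` F)"
    proof (rule division_ofI)
      show "finite (?I ` F)" using F by auto
      fix K assume "K \<in> ?I ` F"
      then show "K \<subseteq> \<Union>(?I ` F)" "K \<noteq> {}" "\<exists>a b. K = cbox a b"
        using FJ(1) by (force simp: less_imp_le)+
    next
      fix K1 K2 assume "K1 \<in> ?I ` F" "K2 \<in> ?I ` F" "K1 \<noteq> K2"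
      then obtain i j where "i \<in> F" "j \<in> F" "K1 = ?I i" "K2 = ?I j" by (elim imageE)
      with \<open>K1 \<noteq> K2\<close> F have "i \<in> C" "j \<in> C" "i \<noteq> j" "K1 = ?I i" "K2 = ?I j" by auto
      then have "K1 \<inter> K2 = {}" using C(3) unfolding disjoint_family_on_def by blast
      then show "interior K1 \<inter> interior K2 = {}" using interior_subset by blast
    qed simp
    have "measure lebesgue (\<Union>(?I ` F)) \<le> (\<Sum>i\<in>F. measure lebesgue (?I i))"
      by (rule measure_UNION_le) (use F in auto)
    also have "\<dots> \<le> (\<Sum>i\<in>F. (f (Sup (?I i)) - f (Inf (?I i))) / q)"
    proof (rule sum_mono)
      fix i assume "i \<in> F"
      then obtain u v where "i = (u, v)" "u < v" "q * (v - u) < f v - f u" using FJ by (cases i) auto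
      then show "measure lebesgue (?I i) \<le> (f (Sup (?I i)) - f (Inf (?I i))) / q"
        using q by (simp add: field_simps)
    qed
    also have "\<dots> = (\<Sum>K\<in>?I ` F. f (Sup K) - f (Inf K)) / q"
      by (simp add: sum.reindex[OF inj] sum_divide_distrib)
    also have "\<dots> \<le> (f b - f a) / q"
      using sum_increments_le[OF f div _ ab] FJ q by (intro divide_right_mono) fastforce+
    finally show ?thesis .
  qed
  have I: "?I i \<in> lmeasurable" for i by (cases i) auto
  have B: "\<Union>(?I ` C) \<in> lmeasurable" "measure lebesgue (\<Union>(?I ` C)) \<le> (f b - f a) / q"
    by (rule fmeasurable_UN_bound[OF C(1) I fin] measure_UN_bound[OF C(1) I fin]; assumption)+
  have N: "E - \<Union>(?I ` C) \<in> null_sets lebesgue"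
    using C(4) by (simp add: negligible_iff_null_sets)
  have "outer_measure_of lebesgue E \<le> outer_measure_of lebesgue (\<Union>(?I ` C) \<union> (E - \<Union>(?I ` C)))"
    by (rule outer_measure_of_mono) auto
  also have "\<dots> = emeasure lebesgue (\<Union>(?I ` C) \<union> (E - \<Union>(?I ` C)))"
    using fmeasurableD[OF B(1)] null_setsD2[OF N] by (intro outer_measure_of_eq sets.Un)
  also have "\<dots> = emeasure lebesgue (\<Union>(?I ` C))"
    using B N by (intro emeasure_Un_null_set) auto
  also have "\<dots> \<le> ennreal ((f b - f a) / q)"
    using B by (simp add: emeasure_eq_measure2 ennreal_leI)
  finally show ?thesis .
qed

text \<open>
  In an open set \<open>G\<close> around \<open>E\<close>, disjoint flat intervals cover almost all of \<open>E\<close>, and their increments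
  add up to at most \<open>p\<close> times the measure of \<open>G\<close>. Within each of them \<open>outer_measure_steep_le\<close> bounds the
  part of \<open>E\<close> by the increment divided by \<open>q\<close>. Hence the outer measure of \<open>E\<close> is at most \<open>p / q\<close> times
  the measure of \<open>G\<close>; passing to the infimum over \<open>G\<close>, it is at most \<open>p / q < 1\<close> times itself.
\<close>

lemma negligible_oscillating_slopes:
  fixes f :: "real \<Rightarrow> real"
  assumes f: "mono_on {a..b} f" and p: "0 < p" "p < q" and Eab: "E \<subseteq> {a<..<b}"
    and flat: "\<And>t d. t \<in> E \<Longrightarrow> 0 < d \<Longrightarrow>
       \<exists>u v. u < v \<and> t \<in> {u..v} \<and> v - u < d \<and> f v - f u < p * (v - u)"
    and steep: "\<And>t d. t \<in> E \<Longrightarrow> 0 < d \<Longrightarrow>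
       \<exists>u v. u < v \<and> t \<in> {u..v} \<and> v - u < d \<and> q * (v - u) < f v - f u"
  shows "negligible E"
proof (cases "E = {}")
  case False
  then have ab: "a < b" using Eab by fastforce
  have small: "\<exists>e>0. \<forall>u v. t \<in> {u..v} \<and> v - u < e \<longrightarrow> {u..v} \<subseteq> S" if "open S" "t \<in> S" for S :: "real set" and t
  proof -
    obtain e where "e > 0" "ball t e \<subseteq> S" using \<open>open S\<close> \<open>t \<in> S\<close> openE by blast
    moreover have "{u..v} \<subseteq> ball t e" if "t \<in> {u..v}" "v - u < e" for u v
      using that by (auto simp: dist_real_def)
    ultimately show ?thesis by blast
  qed
  let ?m = "outer_measure_of lebesgue E"
  have shrink: "?m \<le> ennreal (p / q) * emeasure lebesgue G" if G: "open G" "E \<subseteq> G" for G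
  proof -
    \<comment> \<open>Intervals inside \<open>{a<..<b}\<close> are needed for \<open>f\<close> to be monotone on them.\<close>
    define G' where "G' = G \<inter> {a<..<b}"
    have G': "open G'" "E \<subseteq> G'" "G' \<subseteq> G" "G' \<subseteq> {a<..<b}" using G Eab by (auto simp: G'_def)
    define J where "J = {(u, v). u < v \<and> {u..v} \<subseteq> G' \<and> f v - f u < p * (v - u)}"
    have cov: "\<exists>u v. (u, v) \<in> J \<and> t \<in> {u..v} \<and> v - u < d" if "t \<in> E" "0 < d" for t d
    proof -
      obtain e where e: "e > 0" "\<And>u v. t \<in> {u..v} \<and> v - u < e \<Longrightarrow> {u..v} \<subseteq> G'"
        using small[OF G'(1), of t] G'(2) \<open>t \<in> E\<close> by blast
      obtain u v where uv: "u < v" "t \<in> {u..v}" "v - u < min d e" "f v - f u < p * (v - u)"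
        using flat[OF \<open>t \<in> E\<close>, of "min d e"] e(1) \<open>0 < d\<close> by auto
      then show ?thesis using e(2)[of u v] by (intro exI[of _ u] exI[of _ v]) (auto simp: J_def)
    qed
    obtain C where C: "countable C" "C \<subseteq> J" "disjoint_family_on (\<lambda>(u, v). {u..v}) C"
        "negligible (E - (\<Union>(u, v)\<in>C. {u..v}))"
      by (rule Vitali_covering_intervals[of J E, OF _ cov]) (auto simp: J_def)
    let ?I = "\<lambda>(u, v). {u..v::real}"
    have "\<exists>B. B \<in> sets lebesgue \<and> E \<inter> {u<..<v} \<subseteq> B \<and> emeasure lebesgue B \<le> ennreal (p / q) * emeasure lebesgue {u..v}"
      if "(u, v) \<in> C" for u v
    proof -
      have uv: "u < v" "{u..v} \<subseteq> G'" "f v - f u < p * (v - u)" using that C(2) by (auto simp: J_def)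
      have sub: "{u..v} \<subseteq> {a..b}" using uv(2) G'(4) by fastforce
      have "outer_measure_of lebesgue (E \<inter> {u<..<v}) \<le> ennreal ((f v - f u) / q)"
      proof (rule outer_measure_steep_le[where a=u and b=v and f=f])
        show "mono_on {u..v} f" using f sub mono_on_subset by blast
        fix t d :: real assume t: "t \<in> E \<inter> {u<..<v}" "0 < d"
        obtain e where e: "e > 0" "\<And>u' v'. t \<in> {u'..v'} \<and> v' - u' < e \<Longrightarrow> {u'..v'} \<subseteq> {u<..<v}"
          using small[of "{u<..<v}" t] t by auto
        obtain u' v' where uv': "u' < v'" "t \<in> {u'..v'}" "v' - u' < min d e" "q * (v' - u') < f v' - f u'"
          using steep[of t "min d e"] e(1) t by auto
        moreover have "{u'..v'} \<subseteq> {u..v}" using e(2)[of u' v'] uv' by fastforce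
        ultimately show "\<exists>u' v'. u' < v' \<and> {u'..v'} \<subseteq> {u..v} \<and> t \<in> {u'..v'} \<and> v' - u' < d \<and> q * (v' - u') < f v' - f u'"
          by (metis min_less_iff_conj)
      qed (use uv p in auto)
      also have "\<dots> \<le> ennreal (p / q * (v - u))"
        using divide_right_mono[of "f v - f u" "p * (v - u)" q] uv p by (intro ennreal_leI) simp
      also have "\<dots> = ennreal (p / q) * emeasure lebesgue {u..v}"
        using uv p by (subst ennreal_mult) auto
      finally show ?thesis
        using outer_measure_of_attain[of "E \<inter> {u<..<v}" lebesgue] by auto
    qed
    then have "\<forall>i\<in>C. \<exists>B. B \<in> sets lebesgue \<and> E \<inter> {fst i<..<snd i} \<subseteq> B \<and>
        emeasure lebesgue B \<le> ennreal (p / q) * emeasure lebesgue (?I i)"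
      by auto
    then obtain B where B: "\<And>i. i \<in> C \<Longrightarrow> B i \<in> sets lebesgue"
        "\<And>i. i \<in> C \<Longrightarrow> E \<inter> {fst i<..<snd i} \<subseteq> B i"
        "\<And>i. i \<in> C \<Longrightarrow> emeasure lebesgue (B i) \<le> ennreal (p / q) * emeasure lebesgue (?I i)"
      by metis
    \<comment> \<open>Cutting \<open>B i\<close> down to the interval makes the family disjoint, so its measures add up.\<close>
    define B' where "B' i = B i \<inter> ?I i" for i
    have I[measurable]: "?I i \<in> sets lebesgue" for i by (cases i) auto
    have B'[measurable]: "B' i \<in> sets lebesgue" if "i \<in> C" for i using B(1)[OF that] by (auto simp: B'_def)
    have disj: "disjoint_family_on B' C"
      using C(3) unfolding disjoint_family_on_def B'_def by blast
    have UB: "(\<Union>i\<in>C. B' i) \<in> sets lebesgue" using C(1) B' by (intro sets.countable_UN') auto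
    \<comment> \<open>The endpoints are split off because steep intervals around them may leave the flat interval.\<close>
    define N where "N = (E - (\<Union>(u, v)\<in>C. {u..v})) \<union> fst ` C \<union> snd ` C"
    have "negligible S" if "countable S" for S :: "real set"
      using countable_imp_null_set_lborel[OF that] by (simp add: negligible_iff_null_sets null_sets_completionI)
    then have "negligible N" unfolding N_def
      using C(1,4) by (intro negligible_Un) auto
    then have N: "N \<in> null_sets lebesgue" by (simp add: negligible_iff_null_sets)
    have "E \<subseteq> (\<Union>i\<in>C. B' i) \<union> N"
    proof
      fix t assume t: "t \<in> E"
      show "t \<in> (\<Union>i\<in>C. B' i) \<union> N"
      proof (cases "t \<in> N")
        case False
        then obtain u v where uv: "(u, v) \<in> C" "t \<in> {u..v}" using t by (auto simp: N_def)
        with False have "t \<noteq> u" "t \<noteq> v" by (force simp: N_def)+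
        then have "t \<in> B' (u, v)" using B(2)[OF uv(1)] uv t by (auto simp: B'_def)
        then show ?thesis using uv by blast
      qed simp
    qed
    then have "?m \<le> outer_measure_of lebesgue ((\<Union>i\<in>C. B' i) \<union> N)" by (rule outer_measure_of_mono)
    also have "\<dots> = emeasure lebesgue ((\<Union>i\<in>C. B' i) \<union> N)"
      using UB null_setsD2[OF N] by (intro outer_measure_of_eq sets.Un)
    also have "\<dots> = emeasure lebesgue (\<Union>i\<in>C. B' i)"
      using UB N by (intro emeasure_Un_null_set) auto
    also have "\<dots> = (\<integral>\<^sup>+i. emeasure lebesgue (B' i) \<partial>count_space C)"
      using C(1) disj by (intro emeasure_UN_countable) auto
    also have "\<dots> \<le> (\<integral>\<^sup>+i. ennreal (p / q) * emeasure lebesgue (?I i) \<partial>count_space C)"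
    proof (rule nn_integral_mono)
      fix i assume "i \<in> space (count_space C)"
      then have i: "i \<in> C" by simp
      have "emeasure lebesgue (B' i) \<le> emeasure lebesgue (B i)"
        using B(1)[OF i] by (intro emeasure_mono) (auto simp: B'_def)
      then show "emeasure lebesgue (B' i) \<le> ennreal (p / q) * emeasure lebesgue (?I i)"
        using B(3)[OF i] by order
    qed
    also have "\<dots> = ennreal (p / q) * (\<integral>\<^sup>+i. emeasure lebesgue (?I i) \<partial>count_space C)"
      by (rule nn_integral_cmult) auto
    also have "(\<integral>\<^sup>+i. emeasure lebesgue (?I i) \<partial>count_space C) = emeasure lebesgue (\<Union>i\<in>C. ?I i)"
      using C(1,3) by (intro emeasure_UN_countable[symmetric]) auto
    also have "ennreal (p / q) * emeasure lebesgue (\<Union>i\<in>C. ?I i) \<le> ennreal (p / q) * emeasure lebesgue G"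
    proof (intro mult_left_mono emeasure_mono)
      show "(\<Union>i\<in>C. ?I i) \<subseteq> G" using C(2) G'(3) by (fastforce simp: J_def)
    qed (use G(1) in auto)
    finally show ?thesis .
  qed
  obtain B where B: "B \<in> sets lebesgue" "E \<subseteq> B" "?m = emeasure lebesgue B"
    using outer_measure_of_attain[of E lebesgue] by auto
  have "?m \<le> outer_measure_of lebesgue {a<..<b}" by (rule outer_measure_of_mono[OF Eab])
  also have "\<dots> = ennreal (b - a)" using ab by simp
  finally have "?m < top" by (meson ennreal_less_top order_le_less_trans)
  then obtain m where m: "?m = ennreal m" "0 \<le> m" by (cases ?m) auto
  have "m \<le> p / q * (m + e)" if "e > 0" for e
  proof -
    obtain G where G: "open G" "B \<subseteq> G" "G - B \<in> lmeasurable" "emeasure lebesgue (G - B) < ennreal e"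
      using sets_lebesgue_outer_open[OF B(1) \<open>e > 0\<close>] by blast
    have "emeasure lebesgue G \<le> emeasure lebesgue B + emeasure lebesgue (G - B)"
      using G(2,3) B(1) emeasure_subadditive[of B lebesgue "G - B"] by (simp add: Un_absorb1)
    also have "\<dots> \<le> ennreal m + ennreal e"
      using G(4) B(3) m by (intro add_mono) auto
    finally have GM: "emeasure lebesgue G \<le> ennreal (m + e)" using m \<open>e > 0\<close> by simp
    have "ennreal m \<le> ennreal (p / q) * emeasure lebesgue G"
      using shrink[OF G(1)] B(2) G(2) m by auto
    also have "\<dots> \<le> ennreal (p / q) * ennreal (m + e)" using GM by (intro mult_left_mono) auto
    also have "\<dots> = ennreal (p / q * (m + e))" using p m \<open>e > 0\<close> by (intro ennreal_mult[symmetric]) auto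
    finally show ?thesis using p m \<open>e > 0\<close> by (subst (asm) ennreal_le_iff) auto
  qed
  moreover have "m \<le> (p / q) * m" if *: "\<And>e. e > 0 \<Longrightarrow> m \<le> p / q * (m + e)"
  proof (rule field_le_epsilon)
    fix e :: real assume "0 < e"
    have "m \<le> p / q * (m + e * q / p)" using * \<open>0 < e\<close> p by simp
    also have "\<dots> = p / q * m + e" using p by (simp add: field_simps)
    finally show "m \<le> p / q * m + e" .
  qed
  ultimately have "m \<le> (p / q) * m" by blast
  then have "q * m \<le> p * m" using p by (simp add: field_simps)
  then have "m = 0" using p m(2) by (simp add: mult_le_cancel_right)
  then have "B \<in> null_sets lebesgue" using B m by auto
  then show ?thesis using B(2) negligible_iff_null_sets negligible_subset by blast
qed simp


text \<open>
  Lebesgue's theorem. If the difference quotients at \<open>t\<close> have no finite limit, then either two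
  positive rationals \<open>p < q\<close> separate their lower from their upper limit, so \<open>t\<close> lies in one of countably
  many sets covered by \<open>negligible_oscillating_slopes\<close>, or they are unbounded, and the set of such \<open>t\<close>
  has outer measure at most \<open>(f b - f a) / q\<close> for every \<open>q > 0\<close>.
\<close>

theorem mono_on_imp_differentiable_AE:
  fixes f :: "real \<Rightarrow> real"
  assumes f: "mono_on {a..b} f"
  shows "negligible {t \<in> {a<..<b}. \<not> f differentiable (at t)}"
proof (cases "a < b")
  case ab: True
  let ?near = "\<lambda>t d u v. u < v \<and> t \<in> {u..v} \<and> v - u < d"
  define E where "E p q = {t \<in> {a<..<b}.
      (\<forall>d>0. \<exists>u v. ?near t d u v \<and> f v - f u < p * (v - u)) \<and>
      (\<forall>d>0. \<exists>u v. ?near t d u v \<and> q * (v - u) < f v - f u)}" for p q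
  define steep where "steep t \<longleftrightarrow> (\<forall>q>0. \<forall>d>0. \<exists>u v. ?near t d u v \<and> q * (v - u) < f v - f u)" for t
  define Z where "Z = {t \<in> {a<..<b}. steep t}"
  have Epq: "negligible (E p q)" if "0 < p" "p < q" for p q
    by (rule negligible_oscillating_slopes[OF f that]) (auto simp: E_def)
  have Z: "negligible Z"
  proof -
    have le: "outer_measure_of lebesgue Z \<le> ennreal ((f b - f a) / q)" if "q > 0" for q
    proof (rule outer_measure_steep_le[OF f _ that])
      fix t d :: real assume t: "t \<in> Z" "0 < d"
      define e where "e = min d (min (t - a) (b - t))"
      have "t \<in> {a<..<b}" using t(1) unfolding Z_def by blast
      then have "e > 0" using t(2) by (simp add: e_def)
      have "\<forall>q>0. \<forall>d>0. \<exists>u v. ?near t d u v \<and> q * (v - u) < f v - f u"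
        using t(1) by (simp add: Z_def steep_def)
      from this[rule_format, OF \<open>q > 0\<close> \<open>e > 0\<close>]
      obtain u v where uv: "?near t e u v" "q * (v - u) < f v - f u" by blast
      then have "{u..v} \<subseteq> {a..b}" "v - u < d" by (auto simp: e_def)
      then show "\<exists>u v. u < v \<and> {u..v} \<subseteq> {a..b} \<and> t \<in> {u..v} \<and> v - u < d \<and> q * (v - u) < f v - f u"
        using uv by blast
    qed (use ab in simp)
    obtain B where B: "B \<in> sets lebesgue" "Z \<subseteq> B" "outer_measure_of lebesgue Z = emeasure lebesgue B"
      using outer_measure_of_attain[of Z lebesgue] by auto
    have "emeasure lebesgue B \<le> 0 + ennreal e" if "e > 0" for e
    proof -
      define c where "c = f b - f a"
      have c: "0 \<le> c" unfolding c_def using mono_onD[OF f, of a b] ab by simp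
      then have "(c + 1) / e > 0" using that by simp
      from le[OF this] have "emeasure lebesgue B \<le> ennreal (c / ((c + 1) / e))"
        unfolding B(3) c_def .
      also have "c / ((c + 1) / e) = e * (c / (c + 1))" by simp
      also have "ennreal (e * (c / (c + 1))) \<le> ennreal (e * 1)"
        using that c by (intro ennreal_leI mult_left_mono) auto
      finally show ?thesis by simp
    qed
    then have "emeasure lebesgue B \<le> 0" by (rule ennreal_le_epsilon) auto
    then have "B \<in> null_sets lebesgue" using B by auto
    then show ?thesis using B(2) negligible_iff_null_sets negligible_subset by blast
  qed
  define I :: "(rat \<times> rat) set" where "I = {(p, q). 0 < p \<and> p < q}"
  have "negligible (\<Union>(p, q)\<in>I. E (of_rat p) (of_rat q))"
    by (rule negligible_countable_Union) (auto simp: I_def of_rat_less Epq intro!: countableI_type)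
  moreover have "{t \<in> {a<..<b}. \<not> f differentiable (at t)} \<subseteq> Z \<union> (\<Union>(p, q)\<in>I. E (of_rat p) (of_rat q))"
  proof (rule ccontr)
    assume "\<not> ?thesis"
    then obtain t where t: "t \<in> {a<..<b}" "\<not> f differentiable (at t)" "t \<notin> Z"
        "\<And>p q. 0 < p \<Longrightarrow> p < q \<Longrightarrow> t \<notin> E (of_rat p) (of_rat q)"
      by (auto simp: I_def)
    define \<phi> where "\<phi> h = (f (t + h) - f t) / h" for h
    \<comment> \<open>For \<open>h\<close> of either sign, \<open>\<phi> h\<close> is the slope of \<open>f\<close> over \<open>[U h, V h]\<close>.\<close>
    define U V where "U h = min t (t + h)" and "V h = max t (t + h)" for h
    have UV: "U h < V h" "t \<in> {U h..V h}" "V h - U h = \<bar>h\<bar>" "f (V h) - f (U h) = \<phi> h * (V h - U h)" if "h \<noteq> 0" for h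
      using that by (auto simp: U_def V_def \<phi>_def min_def max_def field_simps)
    have "\<exists>q>0. \<exists>d>0. \<forall>u v. ?near t d u v \<longrightarrow> \<not> q * (v - u) < f v - f u"
    proof -
      have "\<not> steep t" using t(1,3) by (simp add: Z_def)
      then show ?thesis unfolding steep_def by blast
    qed
    then obtain q0 d0 where q0: "q0 > 0" "d0 > 0"
        "\<forall>u v. ?near t d0 u v \<longrightarrow> \<not> q0 * (v - u) < f v - f u" by blast
    have ev: "eventually (\<lambda>h. h \<noteq> 0 \<and> \<bar>h\<bar> < d) (at 0)" if "d > 0" for d :: real
      using that by (auto simp: eventually_at intro!: exI[of _ d])
    have above: "eventually (\<lambda>h. \<phi> h \<le> c) (at 0)"
      if d: "d > 0" and c: "\<forall>u v. ?near t d u v \<longrightarrow> \<not> c * (v - u) < f v - f u" for c d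
      using ev[OF d]
    proof eventually_elim
      case (elim h)
      then have "\<not> c * (V h - U h) < f (V h) - f (U h)" using UV[of h] by (intro c[rule_format]) auto
      then have "\<phi> h * (V h - U h) \<le> c * (V h - U h)" using UV(4)[of h] elim by linarith
      then show ?case using UV[of h] elim by (simp add: mult_le_cancel_right)
    qed
    have below: "eventually (\<lambda>h. c \<le> \<phi> h) (at 0)"
      if d: "d > 0" and c: "\<forall>u v. ?near t d u v \<longrightarrow> \<not> f v - f u < c * (v - u)" for c d
      using ev[OF d]
    proof eventually_elim
      case (elim h)
      then have "\<not> f (V h) - f (U h) < c * (V h - U h)" using UV[of h] by (intro c[rule_format]) auto
      then have "c * (V h - U h) \<le> \<phi> h * (V h - U h)" using UV(4)[of h] elim by linarith
      then show ?case using UV[of h] elim by (simp add: mult_le_cancel_right)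
    qed
    have up: "eventually (\<lambda>h. \<phi> h \<le> q0) (at 0)" by (rule above[OF q0(2,3)])
    have lo: "eventually (\<lambda>h. 0 \<le> \<phi> h) (at 0)"
    proof (rule below)
      show "min (t - a) (b - t) > 0" using t by auto
      show "\<forall>u v. ?near t (min (t - a) (b - t)) u v \<longrightarrow> \<not> f v - f u < 0 * (v - u)"
      proof (intro allI impI)
        fix u v assume "?near t (min (t - a) (b - t)) u v"
        then have "f u \<le> f v" by (intro mono_onD[OF f]) auto
        then show "\<not> f v - f u < 0 * (v - u)" by simp
      qed
    qed
    let ?L = "Liminf (at 0) (\<lambda>h. ereal (\<phi> h))" and ?S = "Limsup (at 0) (\<lambda>h. ereal (\<phi> h))"
    have L0: "0 \<le> ?L" using lo by (intro Liminf_bounded) (auto elim: eventually_mono)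
    have Sq: "?S \<le> ereal q0" using up by (intro Limsup_bounded) (auto elim: eventually_mono)
    have LS: "?L \<le> ?S" by (intro Liminf_le_Limsup) simp
    have "?L = ?S"
    proof (rule ccontr)
      assume "?L \<noteq> ?S"
      then have "?L < ?S" using LS by simp
      then obtain q where q: "?L < ereal (of_rat q)" "ereal (of_rat q) < ?S"
        using ereal_dense3 by blast
      then obtain p where p: "?L < ereal (of_rat p)" "ereal (of_rat p) < ereal (of_rat q)"
        using ereal_dense3 by blast
      have "0 < ereal (of_rat p)" using L0 p(1) by order
      then have p': "0 < p" "p < q" using p by (auto simp: of_rat_less)
      have "\<exists>u v. ?near t d u v \<and> f v - f u < of_rat p * (v - u)" if d: "d > 0" for d
      proof (rule ccontr)
        assume no: "\<not> ?thesis"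
        have "eventually (\<lambda>h. of_rat p \<le> \<phi> h) (at 0)" using no by (intro below[OF d]) blast
        then have "ereal (of_rat p) \<le> ?L" by (intro Liminf_bounded) (auto elim: eventually_mono)
        then show False using p(1) by order
      qed
      moreover have "\<exists>u v. ?near t d u v \<and> of_rat q * (v - u) < f v - f u" if d: "d > 0" for d
      proof (rule ccontr)
        assume no: "\<not> ?thesis"
        have "eventually (\<lambda>h. \<phi> h \<le> of_rat q) (at 0)" using no by (intro above[OF d]) blast
        then have "?S \<le> ereal (of_rat q)" by (intro Limsup_bounded) (auto elim: eventually_mono)
        then show False using q(2) by order
      qed
      ultimately have "t \<in> E (of_rat p) (of_rat q)" using t(1) by (auto simp: E_def)
      then show False using t(4)[OF p'] by blast
    qed
    moreover obtain l where l: "?L = ereal l"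
      using L0 LS Sq by (cases ?L) auto
    ultimately have "((\<lambda>h. ereal (\<phi> h)) \<longlongrightarrow> ereal l) (at 0)"
      by (intro Liminf_eq_Limsup) auto
    then have "(\<phi> \<longlongrightarrow> l) (at 0)" by simp
    then have "DERIV f t :> l" unfolding DERIV_def \<phi>_def .
    then show False using t(2) by (auto simp: real_differentiable_def)
  qed
  ultimately show ?thesis using Z by (meson negligible_Un negligible_subset)
qed auto

section \<open>The fundamental theorem of calculus for absolutely continuous functions\<close>

lemma abs_continuous_on_interval_subset:
  assumes "abs_continuous_on_interval a b f" "{c..d} \<subseteq> {a..b}"
  shows "abs_continuous_on_interval c d f"
  using assms unfolding abs_continuous_on_interval_def by (meson subset_trans)

lemma abs_continuous_on_interval_imp_continuous_on:
  assumes f: "abs_continuous_on_interval a b f"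
  shows "continuous_on {a..b} f"
  unfolding continuous_on_iff
proof (intro ballI allI impI)
  fix s e :: real assume s: "s \<in> {a..b}" and e: "0 < e"
  obtain \<delta> where \<delta>: "\<delta> > 0" "\<And>d. d division_of \<Union>d \<Longrightarrow> \<Union>d \<subseteq> {a..b} \<Longrightarrow> (\<Sum>K\<in>d. Sup K - Inf K) < \<delta> \<Longrightarrow>
      (\<Sum>K\<in>d. \<bar>f (Sup K) - f (Inf K)\<bar>) < e"
    using f e unfolding abs_continuous_on_interval_def by meson
  have close: "\<bar>f v - f u\<bar> < e" if "u \<le> v" "v - u < \<delta>" "u \<in> {a..b}" "v \<in> {a..b}" for u v
  proof -
    have "{{u..v}} division_of \<Union>{{u..v}}" using that division_of_self[of u v] by simp
    then show ?thesis using \<delta>(2)[of "{{u..v}}"] that by auto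
  qed
  show "\<exists>d>0. \<forall>t\<in>{a..b}. dist t s < d \<longrightarrow> dist (f t) (f s) < e"
  proof (intro exI[of _ \<delta>] conjI ballI impI)
    fix t assume t: "t \<in> {a..b}" "dist t s < \<delta>"
    show "dist (f t) (f s) < e"
      using close[of s t] close[of t s] s t by (cases "s \<le> t") (auto simp: dist_real_def abs_minus_commute)
  qed (fact \<delta>)
qed

text \<open>
  Finiteness of the variation propagates from \<open>[a,c]\<close> to \<open>[a,c']\<close> if \<open>c' - c \<le> \<delta> / 2\<close>, where \<open>\<delta>\<close> answers to
  \<open>\<epsilon> = 1\<close>: the intervals to the right of \<open>c\<close> contribute less than \<open>1\<close>, and at most one interval has \<open>c\<close>
  in its interior, with an increment of at most twice the bound \<open>M\<close> of \<open>\<bar>f\<bar>\<close>. Finitely many such steps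
  reach \<open>b\<close>.
\<close>

lemma abs_continuous_on_interval_imp_bounded_variation:
  assumes f: "abs_continuous_on_interval a b f"
  shows "\<exists>B. \<forall>d. d division_of \<Union>d \<and> \<Union>d \<subseteq> {a..b} \<longrightarrow> (\<Sum>K\<in>d. \<bar>f (Sup K) - f (Inf K)\<bar>) \<le> B"
proof -
  obtain \<delta> where \<delta>: "\<delta> > 0" "\<And>d. d division_of \<Union>d \<Longrightarrow> \<Union>d \<subseteq> {a..b} \<Longrightarrow> (\<Sum>K\<in>d. Sup K - Inf K) < \<delta> \<Longrightarrow>
      (\<Sum>K\<in>d. \<bar>f (Sup K) - f (Inf K)\<bar>) < 1"
    using f unfolding abs_continuous_on_interval_def by (meson zero_less_one)
  have "bounded (f ` {a..b})"
    by (intro compact_imp_bounded compact_continuous_image abs_continuous_on_interval_imp_continuous_on f) auto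
  then obtain M where "\<forall>y\<in>f ` {a..b}. norm y \<le> M" unfolding bounded_iff by blast
  then have M: "\<bar>f t\<bar> \<le> M" if "t \<in> {a..b}" for t using that by simp
  define P where "P c \<longleftrightarrow> (\<exists>B. \<forall>d. d division_of \<Union>d \<and> \<Union>d \<subseteq> {a..c} \<longrightarrow> (\<Sum>K\<in>d. \<bar>f (Sup K) - f (Inf K)\<bar>) \<le> B)" for c
  have step: "P c'" if c: "P c" "c \<le> c'" "c' \<le> c + \<delta> / 2" "c' \<le> b" "a \<le> c" for c c'
  proof -
    obtain B where B: "\<And>d. d division_of \<Union>d \<Longrightarrow> \<Union>d \<subseteq> {a..c} \<Longrightarrow> (\<Sum>K\<in>d. \<bar>f (Sup K) - f (Inf K)\<bar>) \<le> B"
      using c(1) unfolding P_def by blast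
    have "(\<Sum>K\<in>d. \<bar>f (Sup K) - f (Inf K)\<bar>) \<le> B + 1 + 2 * M" if d: "d division_of \<Union>d" "\<Union>d \<subseteq> {a..c'}" for d
    proof -
      let ?h = "\<lambda>K. \<bar>f (Sup K) - f (Inf K)\<bar>"
      have K: "\<exists>u v. K = {u..v} \<and> u \<le> v \<and> a \<le> u \<and> v \<le> c'" if K: "K \<in> d" for K
      proof -
        obtain u v where "K = {u..v}" "u \<le> v" using division_ofD(3,4)[OF d(1) K] by auto
        moreover have "K \<subseteq> {a..c'}" using d(2) K by blast
        ultimately show ?thesis by auto
      qed
      define d1 d2 d3 where "d1 = {K \<in> d. Sup K \<le> c}" and "d2 = {K \<in> d. c \<le> Inf K \<and> \<not> Sup K \<le> c}"
        and "d3 = {K \<in> d. Inf K < c \<and> c < Sup K}"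
      have fin: "finite d" using d(1) by auto
      have sub: "d1 division_of \<Union>d1" "d2 division_of \<Union>d2"
        using division_of_subset[OF d(1)] by (auto simp: d1_def d2_def)
      have deq: "d = d1 \<union> (d2 \<union> d3)" by (auto simp: d1_def d2_def d3_def)
      have disj: "d1 \<inter> (d2 \<union> d3) = {}" "d2 \<inter> d3 = {}" by (auto simp: d1_def d2_def d3_def)
      have fin': "finite d1" "finite d2" "finite d3" using fin by (auto simp: d1_def d2_def d3_def)
      have "sum ?h d = sum ?h d1 + (sum ?h d2 + sum ?h d3)"
        unfolding deq sum.union_disjoint[OF fin'(1) finite_UnI[OF fin'(2,3)] disj(1)]
          sum.union_disjoint[OF fin'(2,3) disj(2)] ..
      moreover have "sum ?h d1 \<le> B"
      proof (rule B[OF sub(1)])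
        show "\<Union>d1 \<subseteq> {a..c}" using K by (fastforce simp: d1_def)
      qed
      moreover have "sum ?h d2 \<le> 1"
      proof -
        have U: "\<Union>d2 \<subseteq> {c..c'}" using K by (fastforce simp: d2_def)
        have "(\<Sum>K\<in>d2. Sup K - Inf K) \<le> c' - c"
          using sum_increments_le[of c c' "\<lambda>t. t" d2] U sub(2) c(2) by (simp add: mono_on_def)
        also have "\<dots> < \<delta>" using c(3) \<delta>(1) by simp
        finally show ?thesis using \<delta>(2)[OF sub(2)] U c(4,5) by fastforce
      qed
      moreover have "sum ?h d3 \<le> 2 * M"
      proof -
        have one: "K1 = K2" if "K1 \<in> d3" "K2 \<in> d3" for K1 K2
        proof (rule ccontr)
          assume ne: "K1 \<noteq> K2"
          have dd: "K1 \<in> d" "K2 \<in> d" using that by (auto simp: d3_def)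
          have "c \<in> interior K" if "K \<in> d3" for K
            using K[of K] that by (auto simp: d3_def)
          then show False using division_ofD(5)[OF d(1) dd ne] that by blast
        qed
        have M0: "0 \<le> M" using M[of c] c by auto
        have "card d3 \<le> 1" using one by (metis card_le_Suc0_iff_eq One_nat_def card.infinite le0)
        have "?h K \<le> 2 * M" if K3: "K \<in> d3" for K
        proof -
          obtain u v where "K = {u..v}" "u \<le> v" "a \<le> u" "v \<le> c'" using K[of K] K3 by (auto simp: d3_def)
          then show ?thesis using M[of u] M[of v] c(4) by auto
        qed
        then have "sum ?h d3 \<le> of_nat (card d3) * (2 * M)" by (rule sum_bounded_above)
        also have "\<dots> \<le> 1 * (2 * M)" using M0 \<open>card d3 \<le> 1\<close> by (intro mult_right_mono) auto
        finally show ?thesis by simp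
      qed
      ultimately show ?thesis by linarith
    qed
    then show ?thesis unfolding P_def by blast
  qed
  show ?thesis
  proof (cases "a \<le> b")
    case ab: True
    have Pa: "P a" unfolding P_def
    proof (intro exI[of _ 0] allI impI)
      fix d assume d: "d division_of \<Union>d \<and> \<Union>d \<subseteq> {a..a}"
      have "\<bar>f (Sup K) - f (Inf K)\<bar> = 0" if "K \<in> d" for K
      proof -
        have "K \<noteq> {}" using division_ofD(3)[OF conjunct1[OF d] that] .
        moreover have "K \<subseteq> {a..a}" using conjunct2[OF d] that by blast
        ultimately have "K = {a}" by auto
        then show ?thesis by simp
      qed
      then show "(\<Sum>K\<in>d. \<bar>f (Sup K) - f (Inf K)\<bar>) \<le> 0" by simp
    qed
    have "P (min b (a + of_nat n * (\<delta> / 2)))" for n :: nat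
    proof (induction n)
      case 0 then show ?case using Pa ab by simp
    next
      case (Suc n)
      define x where "x = a + of_nat n * (\<delta> / 2)"
      have "a + of_nat (Suc n) * (\<delta> / 2) = x + \<delta> / 2" "a \<le> x"
        using \<delta>(1) by (auto simp: x_def field_simps)
      note x = this
      have "P (min b x)" using Suc by (simp only: x_def)
      from step[OF this, of "min b (x + \<delta> / 2)"] have "P (min b (x + \<delta> / 2))"
        using x(2) \<delta>(1) ab by (auto simp: min_def)
      then show ?case by (simp only: x(1))
    qed
    moreover obtain n :: nat where "(b - a) / (\<delta> / 2) < of_nat n" using reals_Archimedean2 by blast
    then have "min b (a + of_nat n * (\<delta> / 2)) = b" using \<delta>(1) by (simp add: field_simps)
    ultimately have "P b" by metis
    then show ?thesis unfolding P_def .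
  next
    case False
    have "d = {}" if "d division_of \<Union>d" "\<Union>d \<subseteq> {a..b}" for d
      using that False division_ofD(3)[OF that(1)] by fastforce
    then show ?thesis by (intro exI[of _ 0]) (metis order_refl sum.empty)
  qed
qed

text \<open>
  \<open>V c\<close> is the total variation on \<open>[a,c]\<close>. Adjoining \<open>[s,t]\<close> to a family in \<open>[a,s]\<close> shows
  \<open>V s + \<bar>f t - f s\<bar> \<le> V t\<close>, which contains both monotonicity claims.
\<close>

lemma abs_continuous_on_interval_imp_diff_mono:
  assumes f: "abs_continuous_on_interval a b f"
  obtains V where "mono_on {a..b} V" "mono_on {a..b} (\<lambda>t. V t - f t)"
proof -
  let ?h = "\<lambda>d. \<Sum>K\<in>d. \<bar>f (Sup K) - f (Inf K)\<bar>"
  define S where "S c = ?h ` {d. d division_of \<Union>d \<and> \<Union>d \<subseteq> {a..c}}" for c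
  define V where "V c = Sup (S c)" for c
  have ne: "S c \<noteq> {}" for c
  proof -
    have "{} \<in> {d. d division_of \<Union>d \<and> \<Union>d \<subseteq> {a..c}}" by simp
    then show ?thesis unfolding S_def by blast
  qed
  obtain B where B: "\<And>d. d division_of \<Union>d \<Longrightarrow> \<Union>d \<subseteq> {a..b} \<Longrightarrow> ?h d \<le> B"
    using abs_continuous_on_interval_imp_bounded_variation[OF f] by blast
  have bdd: "bdd_above (S c)" if "c \<le> b" for c
  proof (rule bdd_aboveI[of _ B])
    fix z assume "z \<in> S c"
    then obtain d where "z = ?h d" "d division_of \<Union>d" "\<Union>d \<subseteq> {a..c}" by (auto simp: S_def)
    moreover have "{a..c} \<subseteq> {a..b}" using that by auto
    ultimately show "z \<le> B" using B by blast
  qed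
  have key: "V s + \<bar>f t - f s\<bar> \<le> V t" if st: "a \<le> s" "s \<le> t" "t \<le> b" for s t
  proof (cases "s = t")
    case False
    then have "s < t" using st by simp
    have "z \<le> V t - \<bar>f t - f s\<bar>" if z: "z \<in> S s" for z
    proof -
      obtain d where d: "z = ?h d" "d division_of \<Union>d" "\<Union>d \<subseteq> {a..s}" using z by (auto simp: S_def)
      let ?d = "insert {s..t} d"
      have K: "K \<subseteq> {a..s}" if "K \<in> d" for K using d(3) that by blast
      have notin: "{s..t} \<notin> d" using K \<open>s < t\<close> by fastforce
      have int: "interior K \<inter> interior {s..t} = {}" if "K \<in> d" for K
        using interior_mono[OF K[OF that]] by fastforce
      have "?d division_of \<Union>?d"
      proof (rule division_ofI)
        fix K1 K2 assume "K1 \<in> ?d" "K2 \<in> ?d" "K1 \<noteq> K2"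
        then show "interior K1 \<inter> interior K2 = {}"
          using division_ofD(5)[OF d(2)] int by (metis Int_commute insertE)
      next
        fix K assume K: "K \<in> ?d"
        show "K \<noteq> {}" using K division_ofD(3)[OF d(2)] \<open>s < t\<close> by auto
        show "\<exists>a b. K = cbox a b" using K division_ofD(4)[OF d(2)] by (metis box_real(2) insertE)
      qed (use d(2) in auto)
      moreover have "\<Union>?d \<subseteq> {a..t}" using d(3) st by fastforce
      ultimately have "?h ?d \<in> S t" unfolding S_def by (intro image_eqI[of _ _ ?d]) auto
      then have "?h ?d \<le> V t" unfolding V_def using bdd[of t] st by (intro cSup_upper) auto
      moreover have "?h ?d = \<bar>f t - f s\<bar> + z"
        using d(1,2) notin \<open>s < t\<close> by (subst sum.insert) auto
      ultimately show ?thesis by simp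
    qed
    then have "V s \<le> V t - \<bar>f t - f s\<bar>" unfolding V_def using ne by (intro cSup_least) (auto simp: V_def)
    then show ?thesis by simp
  qed simp
  show ?thesis
  proof (rule that)
    show "mono_on {a..b} V" using key by (fastforce simp: mono_on_def intro: order_trans[OF _ key])
    show "mono_on {a..b} (\<lambda>t. V t - f t)"
    proof (rule mono_onI)
      fix s t assume "s \<in> {a..b}" "t \<in> {a..b}" "s \<le> t"
      then show "V s - f s \<le> V t - f t" using key[of s t] by auto
    qed
  qed
qed

lemma abs_continuous_on_interval_imp_differentiable_AE:
  assumes f: "abs_continuous_on_interval a b f"
  shows "negligible {t \<in> {a<..<b}. \<not> f differentiable (at t)}"
proof -
  obtain V where V: "mono_on {a..b} V" "mono_on {a..b} (\<lambda>t. V t - f t)"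
    using abs_continuous_on_interval_imp_diff_mono[OF f] .
  have "f differentiable (at t)" if "V differentiable (at t)" "(\<lambda>t. V t - f t) differentiable (at t)" for t
    using differentiable_diff[OF that] by simp
  then have "{t \<in> {a<..<b}. \<not> f differentiable (at t)} \<subseteq>
      {t \<in> {a<..<b}. \<not> V differentiable (at t)} \<union> {t \<in> {a<..<b}. \<not> (\<lambda>t. V t - f t) differentiable (at t)}"
    by blast
  then show ?thesis
    using V[THEN mono_on_imp_differentiable_AE] by (meson negligible_Un negligible_subset)
qed


text \<open>
  The gauge at a point off \<open>N\<close> is the usual one, for which \<open>g t\<close> times the length approximates the
  increment of \<open>f\<close>. At the points of \<open>N\<close>, where the integrand may be put to \<open>0\<close>, it is an open set
  \<open>U \<supseteq> N\<close> of measure less than \<open>\<delta>\<close>: the intervals with tags in \<open>N\<close> then have total length less than \<open>\<delta>\<close>,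
  and absolute continuity makes their increments small.
\<close>

lemma abs_continuous_on_interval_has_integral_derivative:
  assumes f: "abs_continuous_on_interval a b f" and ab: "a \<le> b" and N: "negligible N"
    and g: "\<And>t. t \<in> {a..b} - N \<Longrightarrow> (f has_real_derivative g t) (at t)"
  shows "(g has_integral f b - f a) {a..b}"
proof -
  define g' where "g' t = (if t \<in> N then 0 else g t)" for t
  have "(g' has_integral f b - f a) {a..b}"
    unfolding has_integral_real
  proof (intro allI impI)
    fix e :: real assume e: "0 < e"
    obtain \<delta> where \<delta>: "\<delta> > 0" "\<And>d. d division_of \<Union>d \<Longrightarrow> \<Union>d \<subseteq> {a..b} \<Longrightarrow> (\<Sum>K\<in>d. Sup K - Inf K) < \<delta> \<Longrightarrow>
        (\<Sum>K\<in>d. \<bar>f (Sup K) - f (Inf K)\<bar>) < e / 2"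
      using f e unfolding abs_continuous_on_interval_def by (meson half_gt_zero)
    have Nn: "N \<in> null_sets lebesgue" using N by (simp add: negligible_iff_null_sets)
    obtain U where U: "open U" "N \<subseteq> U" "U - N \<in> lmeasurable" "emeasure lebesgue (U - N) < ennreal \<delta>"
      using sets_lebesgue_outer_open[of N \<delta>] Nn \<delta>(1) by blast
    have U\<delta>: "emeasure lebesgue U < ennreal \<delta>"
      using U(1,4) emeasure_Diff_null_set[OF Nn, of U] by simp
    define e' where "e' = e / 2 / (b - a + 1)"
    have e'0: "e' > 0" using e ab by (simp add: e'_def)
    have "e' * (b - a) < e' * (b - a + 1)" using e'0 by (intro mult_strict_left_mono) auto
    also have "\<dots> = e / 2" unfolding e'_def using ab by (intro nonzero_eq_divide_eq[THEN iffD1, OF _ refl]) simp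
    finally have e': "e' > 0" "e' * (b - a) < e / 2" using e'0 by auto
    have "\<exists>d>0. \<forall>y. \<bar>y - t\<bar> < d \<longrightarrow> \<bar>f y - f t - (y - t) * g t\<bar> \<le> e' * \<bar>y - t\<bar>" if "t \<in> {a..b} - N" for t
    proof -
      have "(f has_derivative (\<lambda>h. h * g t)) (at t)"
        using g[OF that] by (simp add: has_field_derivative_def mult_commute_abs)
      then have "\<exists>d>0. \<forall>y\<in>UNIV. norm (y - t) < d \<longrightarrow> norm (f y - f t - (y - t) * g t) \<le> e' * norm (y - t)"
        using e'(1) unfolding has_derivative_within_alt by blast
      then show ?thesis by simp
    qed
    then obtain d where d: "\<And>t. t \<in> {a..b} - N \<Longrightarrow> d t > 0"
        "\<And>t y. t \<in> {a..b} - N \<Longrightarrow> \<bar>y - t\<bar> < d t \<Longrightarrow> \<bar>f y - f t - (y - t) * g t\<bar> \<le> e' * \<bar>y - t\<bar>"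
      by metis
    define \<gamma> where "\<gamma> t = (if t \<in> N then U else if t \<in> {a..b} then ball t (d t) else UNIV)" for t
    have G: "gauge \<gamma>" using U(1,2) d(1) by (auto simp: gauge_def \<gamma>_def)
    have main: "norm ((\<Sum>(t, K)\<in>\<D>. measure lborel K *\<^sub>R g' t) - (f b - f a)) < e"
      if \<D>: "\<D> tagged_division_of {a..b}" "\<gamma> fine \<D>" for \<D>
    proof -
      have fin: "finite \<D>" using \<D>(1) by auto
      have K: "\<exists>u v. K = {u..v} \<and> u \<le> t \<and> t \<le> v \<and> a \<le> u \<and> v \<le> b \<and> {u..v} \<subseteq> \<gamma> t" if tK: "(t, K) \<in> \<D>" for t K
      proof -
        obtain u v where uv: "K = {u..v}" using tagged_division_ofD(4)[OF \<D>(1) tK] by auto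
        moreover have "t \<in> K" "K \<subseteq> {a..b}" using tagged_division_ofD(2,3)[OF \<D>(1) tK] by auto
        moreover have "K \<subseteq> \<gamma> t" using \<D>(2) tK by (auto simp: fine_def)
        ultimately show ?thesis by auto
      qed
      have Kp: "K \<noteq> {}" "K \<subseteq> {a..b}" "K \<subseteq> \<gamma> t" "Inf K \<le> Sup K" "measure lborel K = Sup K - Inf K"
        "measure lebesgue K = Sup K - Inf K" if tK: "(t, K) \<in> \<D>" for t K
        using K[OF tK] by auto
      let ?r = "\<lambda>(t, K). measure lborel K * g' t - (f (Sup K) - f (Inf K))"
      let ?D1 = "{(t, K) \<in> \<D>. t \<in> N}" and ?D2 = "{(t, K) \<in> \<D>. t \<notin> N}"
      have "(\<Sum>(t, K)\<in>\<D>. measure lborel K *\<^sub>R g' t) - (f b - f a) = sum ?r \<D>"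
        using additive_tagged_division_1[OF ab \<D>(1), of f] by (simp add: sum_subtractf split_def)
      also have "\<dots> = sum ?r ?D1 + sum ?r ?D2"
      proof -
        have "\<D> = ?D1 \<union> ?D2" by auto
        then have "sum ?r \<D> = sum ?r (?D1 \<union> ?D2)" by simp
        also have "\<dots> = sum ?r ?D1 + sum ?r ?D2"
          by (rule sum.union_disjoint) (auto intro: finite_subset[OF _ fin])
        finally show ?thesis .
      qed
      finally have eq: "(\<Sum>(t, K)\<in>\<D>. measure lborel K *\<^sub>R g' t) - (f b - f a) = sum ?r ?D1 + sum ?r ?D2" .
      have "\<bar>sum ?r ?D2\<bar> \<le> (\<Sum>(t, K)\<in>?D2. e' * (Sup K - Inf K))"
      proof (rule order_trans[OF sum_abs sum_mono], clarsimp)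
        fix t K assume tK: "(t, K) \<in> \<D>" "t \<notin> N"
        obtain u v where uv: "K = {u..v}" "u \<le> t" "t \<le> v" "a \<le> u" "v \<le> b" "{u..v} \<subseteq> \<gamma> t"
          using K[OF tK(1)] by blast
        have t: "t \<in> {a..b} - N" using uv tK(2) by auto
        have sb: "{u..v} \<subseteq> ball t (d t)" using uv t tK(2) by (simp add: \<gamma>_def)
        have "u \<in> ball t (d t)" "v \<in> ball t (d t)"
          by (rule subsetD[OF sb]; use uv in simp)+
        then have "\<bar>f u - f t - (u - t) * g t\<bar> \<le> e' * \<bar>u - t\<bar>" "\<bar>f v - f t - (v - t) * g t\<bar> \<le> e' * \<bar>v - t\<bar>"
          using d(2)[OF t, of u] d(2)[OF t, of v] by (simp_all add: dist_real_def abs_minus_commute)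
        then have "\<bar>f u - f t - (u - t) * g t\<bar> + \<bar>f v - f t - (v - t) * g t\<bar> \<le> e' * (v - u)"
          using uv by (simp add: algebra_simps)
        moreover have "(v - u) * g t - (f v - f u) = (f u - f t - (u - t) * g t) - (f v - f t - (v - t) * g t)"
          by (simp add: algebra_simps)
        ultimately have "\<bar>(v - u) * g t - (f v - f u)\<bar> \<le> e' * (v - u)" by linarith
        then show "\<bar>measure lborel K * g' t - (f (Sup K) - f (Inf K))\<bar> \<le> e' * (Sup K - Inf K)"
          using uv tK(2) by (simp add: g'_def)
      qed
      also have "\<dots> \<le> (\<Sum>(t, K)\<in>\<D>. e' * (Sup K - Inf K))"
        using fin e'(1) Kp(4) by (intro sum_mono2) auto
      also have "\<dots> = e' * (b - a)"
        using additive_tagged_division_1[OF ab \<D>(1), of "\<lambda>t. t"]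
        by (simp add: sum_distrib_left[symmetric] split_def)
      finally have D2: "\<bar>sum ?r ?D2\<bar> < e / 2" using e'(2) by linarith
      have part: "?D1 tagged_partial_division_of {a..b}"
        by (rule tagged_partial_division_subset[OF conjunct1[OF \<D>(1)[unfolded tagged_division_of_def]]]) auto
      let ?d = "snd ` ?D1"
      have div: "?d division_of \<Union>?d" by (rule partial_division_of_tagged_division[OF part])
      have sub: "\<Union>?d \<subseteq> {a..b}"
      proof (rule Union_least)
        fix K assume "K \<in> ?d"
        then obtain t where "(t, K) \<in> \<D>" by auto
        then show "K \<subseteq> {a..b}" by (rule Kp(2))
      qed
      have subU: "\<Union>?d \<subseteq> U"
      proof (rule Union_least)
        fix K assume "K \<in> ?d"
        then obtain t where "(t, K) \<in> \<D>" "t \<in> N" by auto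
        then show "K \<subseteq> U" using Kp(3)[of t K] by (simp add: \<gamma>_def)
      qed
      have "(\<Sum>K\<in>?d. Sup K - Inf K) = (\<Sum>K\<in>?d. measure lebesgue K)"
        using Kp(6) by (intro sum.cong) auto
      also have "\<dots> = measure lebesgue (\<Union>?d)" by (rule content_division[OF div])
      also have "\<dots> < \<delta>"
      proof -
        have "\<Union>?d \<in> lmeasurable" using div by (rule lmeasurable_division)
        then have "ennreal (measure lebesgue (\<Union>?d)) = emeasure lebesgue (\<Union>?d)" by (simp add: emeasure_eq_measure2)
        also have "\<dots> \<le> emeasure lebesgue U" using U(1) subU by (intro emeasure_mono) auto
        also note U\<delta>
        finally show ?thesis by (simp add: ennreal_less_iff)
      qed
      finally have small: "(\<Sum>K\<in>?d. \<bar>f (Sup K) - f (Inf K)\<bar>) < e / 2" by (rule \<delta>(2)[OF div sub])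
      \<comment> \<open>Distinct tags can share an interval only if it has no interior. The summand is made to vanish on
        all of these, the empty set included.\<close>
      let ?h = "\<lambda>K. if K = {} then 0 else \<bar>f (Sup K) - f (Inf K)\<bar>"
      have "\<bar>sum ?r ?D1\<bar> \<le> (\<Sum>(t, K)\<in>?D1. ?h K)"
        using Kp(1) by (intro order_trans[OF sum_abs sum_mono]) (auto simp: g'_def)
      also have "\<dots> = (\<Sum>K\<in>?d. ?h K)"
      proof (rule sum.over_tagged_division_lemma)
        show "?D1 tagged_division_of \<Union>?d" using tagged_partial_division_of_Union_self[OF part] by simp
        fix u v :: real assume "box u v = {}"
        then show "?h (cbox u v) = 0" by (auto simp: le_less)
      qed
      also have "\<dots> = (\<Sum>K\<in>?d. \<bar>f (Sup K) - f (Inf K)\<bar>)"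
        using Kp(1) by (intro sum.cong) auto
      finally show ?thesis using D2 small unfolding eq by simp
    qed
    show "\<exists>\<gamma>. gauge \<gamma> \<and> (\<forall>\<D>. \<D> tagged_division_of {a..b} \<and> \<gamma> fine \<D> \<longrightarrow>
        norm ((\<Sum>(x, k)\<in>\<D>. measure lborel k *\<^sub>R g' x) - (f b - f a)) < e)"
      by (rule exI[of _ \<gamma>], intro conjI allI impI G main) simp_all
  qed
  then show ?thesis by (rule has_integral_spike[OF N, rotated]) (simp add: g'_def)
qed

text \<open>
  The integral of the derivative over every subinterval is the increment of \<open>f\<close>, so bounded variation of
  \<open>f\<close> turns Henstock-Kurzweil integrability into absolute integrability.
\<close>

theorem abs_continuous_FTC:
  assumes f: "abs_continuous_on_interval a b f" and ab: "a \<le> b"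
  shows "deriv f absolutely_integrable_on {a..b}" and "(deriv f has_integral f b - f a) {a..b}"
proof -
  define N where "N = {t \<in> {a<..<b}. \<not> f differentiable (at t)} \<union> {a, b}"
  have N: "negligible N" unfolding N_def
    using abs_continuous_on_interval_imp_differentiable_AE[OF f] by (intro negligible_Un) auto
  have g: "(f has_real_derivative deriv f t) (at t)" if "t \<in> {a..b} - N" for t
    using that by (auto simp: N_def DERIV_deriv_iff_real_differentiable)
  have sub: "(deriv f has_integral f v - f u) {u..v}" if "{u..v} \<subseteq> {a..b}" "u \<le> v" for u v
    by (rule abs_continuous_on_interval_has_integral_derivative[OF abs_continuous_on_interval_subset[OF f that(1)] that(2) N])
      (use that g in auto)
  show int: "(deriv f has_integral f b - f a) {a..b}" by (rule sub) (use ab in auto)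
  obtain B where B: "\<And>d. d division_of \<Union>d \<Longrightarrow> \<Union>d \<subseteq> {a..b} \<Longrightarrow> (\<Sum>K\<in>d. \<bar>f (Sup K) - f (Inf K)\<bar>) \<le> B"
    using abs_continuous_on_interval_imp_bounded_variation[OF f] by blast
  have "(\<Sum>K\<in>d. norm (integral K (deriv f))) \<le> B" if d: "d division_of cbox a b" for d
  proof -
    have "(\<Sum>K\<in>d. norm (integral K (deriv f))) = (\<Sum>K\<in>d. \<bar>f (Sup K) - f (Inf K)\<bar>)"
    proof (rule sum.cong)
      fix K assume "K \<in> d"
      then obtain u v where "K = {u..v}" "u \<le> v" "{u..v} \<subseteq> {a..b}"
        using division_ofD(2,3,4)[OF d, of K] by fastforce
      then show "norm (integral K (deriv f)) = \<bar>f (Sup K) - f (Inf K)\<bar>"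
        using integral_unique[OF sub[of u v]] by simp
    qed simp
    also have "\<dots> \<le> B" using B[of d] d division_ofD(6)[OF d] by simp
    finally show ?thesis .
  qed
  then show "deriv f absolutely_integrable_on {a..b}"
    using bounded_variation_absolutely_integrable_interval[of "deriv f" a b B] int by auto
qed

section \<open>Riemann-Liouville integrals\<close>

lemma Gamma_add_one_pos: "0 < \<mu> \<Longrightarrow> Gamma (\<mu> + 1) = \<mu> * Gamma \<mu>" for \<mu> :: real
  by (rule Gamma_plus1) (auto elim!: nonpos_Ints_cases)

lemma Gamma_pos_nonzero: "0 < \<mu> \<Longrightarrow> Gamma \<mu> \<noteq> 0" for \<mu> :: real
  using Gamma_real_pos[of \<mu>] by linarith

text \<open>
  The Beta integral after the substitution \<open>s = r + (\<tau> - r) t\<close>; this is the convolution of the two kernels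
  that meet in the semigroup law.
\<close>

lemma has_bochner_integral_Beta_interval:
  fixes \<mu> \<nu> r \<tau> :: real
  assumes \<mu>: "0 < \<mu>" and \<nu>: "0 < \<nu>" and r: "r < \<tau>"
  shows "has_bochner_integral lborel
    (\<lambda>s. indicator {r<..<\<tau>} s * ((\<tau> - s) powr (\<mu> - 1) * (s - r) powr (\<nu> - 1)))
    (Beta \<mu> \<nu> * (\<tau> - r) powr (\<mu> + \<nu> - 1))"
proof -
  let ?c = "\<tau> - r" and ?f = "\<lambda>t::real. indicator {0..1} t * (t powr (\<nu> - 1) * (1 - t) powr (\<mu> - 1))"
  have int: "set_integrable lborel {0..1} (\<lambda>t. t powr (\<nu> - 1) * (1 - t) powr (\<mu> - 1))"
    by (rule integrable_Beta[OF \<nu> \<mu>])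
  have "has_bochner_integral lborel ?f (Beta \<nu> \<mu>)"
    using int set_borel_integral_eq_integral(2)[OF int] integral_unique[OF has_integral_Beta_real[OF \<nu> \<mu>]]
    by (simp add: has_bochner_integral_iff set_integrable_def set_lebesgue_integral_def)
  then have f: "has_bochner_integral lborel (\<lambda>t. ?c powr (\<mu> + \<nu> - 2) * ?f t) (?c powr (\<mu> + \<nu> - 2) * Beta \<nu> \<mu>)"
    by (intro has_bochner_integral_mult_right) auto
  have eq: "indicator {r<..<\<tau>} (r + ?c * t) * ((\<tau> - (r + ?c * t)) powr (\<mu> - 1) * ((r + ?c * t) - r) powr (\<nu> - 1))
      = ?c powr (\<mu> + \<nu> - 2) * ?f t" for t
  proof -
    have "r < r + ?c * t \<longleftrightarrow> 0 < t" using r by (simp add: zero_less_mult_iff)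
    moreover have "r + ?c * t < \<tau> \<longleftrightarrow> t < 1"
    proof -
      have "r + ?c * t < \<tau> \<longleftrightarrow> ?c * t < ?c * 1" by (simp add: algebra_simps)
      then show ?thesis using r by (simp only: mult_less_cancel_left_pos)
    qed
    ultimately have ind: "r + ?c * t \<in> {r<..<\<tau>} \<longleftrightarrow> 0 < t \<and> t < 1" by simp
    show ?thesis
    proof (cases "0 < t \<and> t < 1")
      case True
      have "\<tau> - (r + ?c * t) = ?c * (1 - t)" by (simp add: algebra_simps)
      moreover have "?c powr (\<mu> + \<nu> - 2) = ?c powr (\<mu> - 1) * ?c powr (\<nu> - 1)"
        by (simp add: powr_add[symmetric])
      ultimately show ?thesis using True ind r by (simp add: powr_mult)
    next
      case False
      then have "?f t = 0" by (auto simp: indicator_def not_less)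
      then show ?thesis using False ind by simp
    qed
  qed
  have "Beta \<mu> \<nu> * ?c powr (\<mu> + \<nu> - 1) /\<^sub>R \<bar>?c\<bar> = ?c powr (\<mu> + \<nu> - 2) * Beta \<nu> \<mu>"
  proof -
    have "?c powr (\<mu> + \<nu> - 1) = ?c powr (\<mu> + \<nu> - 2) * ?c powr 1" unfolding powr_add[symmetric] by simp
    also have "?c powr 1 = ?c" using r by simp
    finally have e: "?c powr (\<mu> + \<nu> - 1) = ?c powr (\<mu> + \<nu> - 2) * ?c" .
    have "Beta \<nu> \<mu> * (x * c) /\<^sub>R \<bar>c\<bar> = x * Beta \<nu> \<mu>" if "c > 0" for x c :: real
      using that by simp
    then show ?thesis unfolding e Beta_commute[of \<mu> \<nu>] using r by simp
  qed
  note X = this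
  show ?thesis
  proof (rule lborel_has_bochner_integral_real_affine_iff[where c = ?c and t = r, THEN iffD2])
    show "?c \<noteq> 0" using r by simp
  qed (simp only: eq X f)
qed

text \<open>
  The case \<open>\<nu> = 1\<close>, \<open>r = 0\<close> of the Beta integral, in which the second kernel is constant.
\<close>

lemma has_bochner_integral_powr_kernel:
  fixes \<mu> \<tau> :: real
  assumes \<mu>: "0 < \<mu>" and \<tau>: "0 < \<tau>"
  shows "has_bochner_integral lebesgue (\<lambda>s. indicator {0..\<tau>} s * (\<tau> - s) powr (\<mu> - 1)) (\<tau> powr \<mu> / \<mu>)"
proof -
  have B: "Beta \<mu> 1 = 1 / \<mu>"
    using \<mu> Gamma_pos_nonzero[OF \<mu>] by (simp add: Beta_def Gamma_add_one_pos)
  have "has_bochner_integral lborel (\<lambda>s. indicator {0<..<\<tau>} s * ((\<tau> - s) powr (\<mu> - 1) * (s - 0) powr (1 - 1))) (\<tau> powr \<mu> / \<mu>)"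
    using has_bochner_integral_Beta_interval[OF \<mu> zero_less_one \<tau>] B by simp
  also have "?this \<longleftrightarrow> has_bochner_integral lborel (\<lambda>s. indicator {0..\<tau>} s * (\<tau> - s) powr (\<mu> - 1)) (\<tau> powr \<mu> / \<mu>)"
  proof (intro has_bochner_integral_cong_AE)
    have "AE s in lborel. s \<noteq> 0 \<and> s \<noteq> \<tau>"
      by (intro AE_conjI AE_lborel_singleton)
    then show "AE s in lborel. indicator {0<..<\<tau>} s * ((\<tau> - s) powr (\<mu> - 1) * (s - 0) powr (1 - 1)) =
        indicator {0..\<tau>} s * (\<tau> - s) powr (\<mu> - 1)"
      by eventually_elim (auto simp: indicator_def)
  qed auto
  finally show ?thesis
    by (simp add: has_bochner_integral_iff integrable_completion integral_completion)
qed

lemma RL_integral_borel: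
  assumes [measurable]: "g \<in> borel_measurable borel"
  shows "RL_integral \<mu> g \<tau> = 1 / Gamma \<mu> * (\<integral>s. indicator {0..\<tau>} s * ((\<tau> - s) powr (\<mu> - 1) * g s) \<partial>lborel)"
  unfolding RL_integral_def set_lebesgue_integral_def by (subst integral_completion) auto

lemma borel_measurable_RL_integral [measurable]:
  assumes g[measurable]: "g \<in> borel_measurable borel"
  shows "RL_integral \<mu> g \<in> borel_measurable borel"
proof -
  have eq: "RL_integral \<mu> g = (\<lambda>\<tau>. 1 / Gamma \<mu> * (\<integral>s. indicator {p. 0 \<le> snd p \<and> snd p \<le> fst p} (\<tau>, s) * ((\<tau> - s) powr (\<mu> - 1) * g s) \<partial>lborel))"
    unfolding RL_integral_borel[OF g] fun_eq_iff by (auto simp: indicator_def intro!: Bochner_Integration.integral_cong)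
  show ?thesis unfolding eq by measurable
qed

text \<open>
  Fubini: exchanging the order of integration leaves the convolution of the two kernels as the inner
  integral, which is a multiple of \<open>(\<tau> - r)\<^sup>\<mu>\<^sup>+\<^sup>\<nu>\<^sup>-\<^sup>1\<close>. The same computation with \<open>\<bar>g\<bar>\<close> shows that the
  integrability assumption amounts to absolute convergence of the double integral.
\<close>

theorem RL_integral_semigroup:
  fixes g :: "real \<Rightarrow> real"
  assumes g[measurable]: "g \<in> borel_measurable borel" and \<mu>: "0 < \<mu>" and \<nu>: "0 < \<nu>"
    and int: "set_integrable lborel {0..\<tau>} (\<lambda>s. (\<tau> - s) powr (\<mu> + \<nu> - 1) * g s)"
  shows "RL_integral \<mu> (RL_integral \<nu> g) \<tau> = RL_integral (\<mu> + \<nu>) g \<tau>"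
proof -
  \<comment> \<open>The strict inequalities agree with the closed intervals of \<open>RL_integral\<close>, whose kernels vanish at the
    upper end because \<open>0 powr a = 0\<close>.\<close>
  define k where "k r s = indicator {p. fst p < snd p \<and> snd p < \<tau>} (r, s) * ((\<tau> - s) powr (\<mu> - 1) * (s - r) powr (\<nu> - 1))" for r s
  define F where "F r s = indicator {0..\<tau>} r * g r * k r s" for r s
  have k: "has_bochner_integral lborel (k r) (Beta \<mu> \<nu> * (\<tau> - r) powr (\<mu> + \<nu> - 1))" if "r \<le> \<tau>" for r
  proof (cases "r = \<tau>")
    case True
    then have "k r = (\<lambda>s. 0)" by (auto simp: k_def fun_eq_iff indicator_def)
    then show ?thesis using True by (simp add: has_bochner_integral_zero)
  next
    case False
    then have "k r = (\<lambda>s. indicator {r<..<\<tau>} s * ((\<tau> - s) powr (\<mu> - 1) * (s - r) powr (\<nu> - 1)))"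
      by (auto simp: k_def fun_eq_iff indicator_def)
    then show ?thesis using has_bochner_integral_Beta_interval[OF \<mu> \<nu>, of r \<tau>] False that by simp
  qed
  have k0: "0 \<le> k r s" for r s by (simp add: k_def)
  have Fint: "has_bochner_integral lborel (F r) (Beta \<mu> \<nu> * (indicator {0..\<tau>} r * ((\<tau> - r) powr (\<mu> + \<nu> - 1) * g r)))" for r
  proof (cases "r \<in> {0..\<tau>}")
    case True
    have "has_bochner_integral lborel (\<lambda>s. indicator {0..\<tau>} r * g r * k r s)
        (indicator {0..\<tau>} r * g r * (Beta \<mu> \<nu> * (\<tau> - r) powr (\<mu> + \<nu> - 1)))"
      using k[of r] True by (intro has_bochner_integral_mult_right) auto
    then show ?thesis by (simp add: F_def[abs_def] mult_ac)
  next
    case False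
    then have "F r = (\<lambda>s. 0)" by (simp add: F_def fun_eq_iff)
    then show ?thesis using False by (simp add: has_bochner_integral_zero)
  qed
  have Fnorm: "(\<integral>s. norm (F r s) \<partial>lborel) = Beta \<mu> \<nu> * \<bar>indicator {0..\<tau>} r * ((\<tau> - r) powr (\<mu> + \<nu> - 1) * g r)\<bar>" for r
  proof (cases "r \<in> {0..\<tau>}")
    case True
    have "norm (F r s) = \<bar>g r\<bar> * k r s" for s using True k0 by (simp add: F_def abs_mult)
    then show ?thesis using True k[of r] by (simp add: has_bochner_integral_iff abs_mult)
  qed (simp add: F_def)
  have meas: "case_prod F \<in> borel_measurable (lborel \<Otimes>\<^sub>M lborel)"
    unfolding F_def k_def by measurable
  have int': "integrable lborel (\<lambda>r. indicator {0..\<tau>} r * ((\<tau> - r) powr (\<mu> + \<nu> - 1) * g r))"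
    using int by (simp add: set_integrable_def)
  have FI: "integrable (lborel \<Otimes>\<^sub>M lborel) (case_prod F)"
  proof (rule lborel_pair.Fubini_integrable[OF meas])
    show "integrable lborel (\<lambda>r. \<integral>s. norm (case (r, s) of (r, s) \<Rightarrow> F r s) \<partial>lborel)"
      using int' by (simp only: prod.case Fnorm) (intro integrable_mult_right integrable_abs)
    show "AE r in lborel. integrable lborel (\<lambda>s. case (r, s) of (r, s) \<Rightarrow> F r s)"
      using Fint by (simp add: has_bochner_integral_iff)
  qed
  have inner: "(\<integral>r. F r s \<partial>lborel) = Gamma \<nu> * (indicator {0..\<tau>} s * ((\<tau> - s) powr (\<mu> - 1) * RL_integral \<nu> g s))" for s
  proof -
    have "F r s = (indicator {0..\<tau>} s * (\<tau> - s) powr (\<mu> - 1)) * (indicator {0..s} r * ((s - r) powr (\<nu> - 1) * g r))" for r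
      by (cases "r = s"; cases "s = \<tau>") (auto simp: F_def k_def indicator_def)
    then show ?thesis
      unfolding RL_integral_borel[OF g] using Gamma_pos_nonzero[OF \<nu>] by simp
  qed
  have "Gamma \<nu> * Gamma \<mu> * RL_integral \<mu> (RL_integral \<nu> g) \<tau> = (\<integral>s. (\<integral>r. F r s \<partial>lborel) \<partial>lborel)"
    unfolding inner RL_integral_borel[OF borel_measurable_RL_integral[OF g]]
    using Gamma_pos_nonzero[OF \<mu>] by simp
  also have "\<dots> = (\<integral>r. (\<integral>s. F r s \<partial>lborel) \<partial>lborel)"
    by (rule lborel_pair.Fubini_integral[OF FI])
  also have "\<dots> = Beta \<mu> \<nu> * (\<integral>r. indicator {0..\<tau>} r * ((\<tau> - r) powr (\<mu> + \<nu> - 1) * g r) \<partial>lborel)"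
    using Fint by (simp add: has_bochner_integral_iff)
  also have "\<dots> = Beta \<mu> \<nu> * Gamma (\<mu> + \<nu>) * RL_integral (\<mu> + \<nu>) g \<tau>"
    unfolding RL_integral_borel[OF g] using Gamma_pos_nonzero[of "\<mu> + \<nu>"] \<mu> \<nu> by simp
  also have "Beta \<mu> \<nu> * Gamma (\<mu> + \<nu>) = Gamma \<nu> * Gamma \<mu>"
    using Gamma_pos_nonzero[of "\<mu> + \<nu>"] \<mu> \<nu> by (simp add: Beta_def)
  finally show ?thesis using Gamma_pos_nonzero[OF \<mu>] Gamma_pos_nonzero[OF \<nu>] by simp
qed

text \<open>
  A divergent integral has the value \<open>0\<close>, for which the bound holds as well.
\<close>

lemma RL_integral_abs_le:
  assumes \<mu>: "0 < \<mu>" and \<tau>: "0 < \<tau>" and W: "0 \<le> W" and D: "\<And>s. 0 < s \<Longrightarrow> s \<le> \<tau> \<Longrightarrow> \<bar>D s\<bar> \<le> W"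
  shows "\<bar>RL_integral \<mu> D \<tau>\<bar> \<le> W * \<tau> powr \<mu> / Gamma (\<mu> + 1)"
proof -
  let ?f = "\<lambda>s. indicator {0..\<tau>} s *\<^sub>R ((\<tau> - s) powr (\<mu> - 1) * D s)"
  let ?k = "\<lambda>s. indicator {0..\<tau>} s * (\<tau> - s) powr (\<mu> - 1)"
  have k: "has_bochner_integral lebesgue ?k (\<tau> powr \<mu> / \<mu>)" by (rule has_bochner_integral_powr_kernel[OF \<mu> \<tau>])
  have "\<bar>integral\<^sup>L lebesgue ?f\<bar> \<le> W * (\<tau> powr \<mu> / \<mu>)"
  proof (cases "integrable lebesgue ?f")
    case True
    have "\<bar>integral\<^sup>L lebesgue ?f\<bar> \<le> (\<integral>s. \<bar>?f s\<bar> \<partial>lebesgue)" by (rule integral_abs_bound)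
    also have "\<dots> \<le> (\<integral>s. W * ?k s \<partial>lebesgue)"
    proof (rule integral_mono_AE)
      have "AE s in lborel. s \<noteq> (0::real)" by (rule AE_lborel_singleton)
      then have "AE s in lebesgue. s \<noteq> (0::real)" by (rule AE_completion)
      then show "AE s in lebesgue. \<bar>?f s\<bar> \<le> W * ?k s"
      proof eventually_elim
        case (elim s)
        show ?case
        proof (cases "s \<in> {0..\<tau>}")
          case True
          then have "\<bar>D s\<bar> * (\<tau> - s) powr (\<mu> - 1) \<le> W * (\<tau> - s) powr (\<mu> - 1)"
            using D[of s] elim by (intro mult_right_mono) auto
          then show ?thesis using True by (simp add: abs_mult mult.commute)
        qed simp
      qed
    qed (use True k in \<open>auto simp: has_bochner_integral_iff\<close>)
    also have "\<dots> = W * (\<tau> powr \<mu> / \<mu>)" using k by (simp add: has_bochner_integral_iff)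
    finally show ?thesis .
  next
    case False
    then show ?thesis using W \<mu> by (simp add: not_integrable_integral_eq)
  qed
  then have "\<bar>integral\<^sup>L lebesgue ?f\<bar> / Gamma \<mu> \<le> W * (\<tau> powr \<mu> / \<mu>) / Gamma \<mu>"
    using Gamma_real_pos[OF \<mu>] by (intro divide_right_mono) auto
  also have "\<dots> = W * \<tau> powr \<mu> / Gamma (\<mu> + 1)"
    using \<mu> by (simp add: Gamma_add_one_pos)
  finally show ?thesis
    using Gamma_real_pos[OF \<mu>] by (simp add: RL_integral_def set_lebesgue_integral_def abs_mult)
qed

text \<open>
  With \<open>s = \<tau> u\<close> the quotient becomes \<open>1 / \<Gamma>(\<mu>)\<close> times the integral of \<open>(1 - u)\<^sup>\<mu>\<^sup>-\<^sup>1 D (\<tau> u)\<close> over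
  \<open>[0,1]\<close>, whose integrand is dominated by \<open>W (1 - u)\<^sup>\<mu>\<^sup>-\<^sup>1\<close> and converges to \<open>L (1 - u)\<^sup>\<mu>\<^sup>-\<^sup>1\<close>.
\<close>

lemma RL_integral_asymptotic:
  fixes D :: "real \<Rightarrow> real"
  assumes \<mu>: "0 < \<mu>" and D[measurable]: "D \<in> borel_measurable borel"
    and bound: "\<And>s. 0 < s \<Longrightarrow> \<bar>D s\<bar> \<le> W" and lim: "(D \<longlongrightarrow> L) at_top"
  shows "((\<lambda>\<tau>. RL_integral \<mu> D \<tau> / \<tau> powr \<mu>) \<longlongrightarrow> L / Gamma (\<mu> + 1)) at_top"
proof -
  let ?k = "\<lambda>u. indicator {0..1} u * (1 - u) powr (\<mu> - 1)"
  have k: "integrable lborel ?k" "integral\<^sup>L lborel ?k = 1 / \<mu>"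
    using has_bochner_integral_powr_kernel[OF \<mu> zero_less_one]
    by (simp_all add: has_bochner_integral_iff integrable_completion integral_completion)
  have scale: "RL_integral \<mu> D \<tau> / \<tau> powr \<mu> = (\<integral>u. ?k u * D (\<tau> * u) \<partial>lborel) / Gamma \<mu>" if \<tau>: "0 < \<tau>" for \<tau>
  proof -
    have pt: "indicator {0..\<tau>} (0 + \<tau> * u) * ((\<tau> - (0 + \<tau> * u)) powr (\<mu> - 1) * D (0 + \<tau> * u)) =
        \<tau> powr (\<mu> - 1) * (?k u * D (\<tau> * u))" for u
    proof -
      have "\<tau> * u \<in> {0..\<tau>} \<longleftrightarrow> u \<in> {0..1}" using \<tau> by (auto simp: zero_le_mult_iff)
      moreover have "\<tau> - \<tau> * u = \<tau> * (1 - u)" by (simp add: algebra_simps)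
      ultimately show ?thesis using \<tau> by (auto simp: indicator_def powr_mult)
    qed
    have "(\<integral>s. indicator {0..\<tau>} s * ((\<tau> - s) powr (\<mu> - 1) * D s) \<partial>lborel) = \<bar>\<tau>\<bar> *\<^sub>R (\<integral>u. indicator {0..\<tau>} (0 + \<tau> * u) * ((\<tau> - (0 + \<tau> * u)) powr (\<mu> - 1) * D (0 + \<tau> * u)) \<partial>lborel)"
      using \<tau> by (intro lborel_integral_real_affine) auto
    also have "\<dots> = (\<tau> * \<tau> powr (\<mu> - 1)) * (\<integral>u. ?k u * D (\<tau> * u) \<partial>lborel)"
      unfolding pt using \<tau> by simp
    also have "\<tau> * \<tau> powr (\<mu> - 1) = \<tau> powr \<mu>" using \<tau> by (simp add: powr_mult_base)
    finally show ?thesis using \<tau> by (simp add: RL_integral_borel[OF D])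
  qed
  have "((\<lambda>\<tau>. \<integral>u. ?k u * D (\<tau> * u) \<partial>lborel) \<longlongrightarrow> (\<integral>u. ?k u * L \<partial>lborel)) at_top"
  proof (rule integral_dominated_convergence_at_top[where w = "\<lambda>u. W * ?k u"])
    have ne: "AE u in lborel. u \<noteq> (0::real)" by (rule AE_lborel_singleton)
    then show "AE u in lborel. ((\<lambda>\<tau>. ?k u * D (\<tau> * u)) \<longlongrightarrow> ?k u * L) at_top"
    proof eventually_elim
      case (elim u)
      show ?case
      proof (cases "u > 0")
        case True
        then have "filterlim (\<lambda>\<tau>. \<tau> * u) at_top at_top"
          by (intro filterlim_at_top_mult_tendsto_pos[OF tendsto_const _ filterlim_ident])
        from filterlim_compose[OF lim this] show ?thesis by (intro tendsto_mult tendsto_const)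
      next
        case False
        then show ?thesis using elim by simp
      qed
    qed
    show "\<forall>\<^sub>F \<tau> in at_top. AE u in lborel. norm (?k u * D (\<tau> * u)) \<le> W * ?k u"
      using eventually_gt_at_top[of 0]
    proof eventually_elim
      case (elim \<tau>)
      from ne show ?case
      proof eventually_elim
        case u: (elim u)
        show ?case
        proof (cases "u \<in> {0..1}")
          case True
          then have "\<bar>D (\<tau> * u)\<bar> * (1 - u) powr (\<mu> - 1) \<le> W * (1 - u) powr (\<mu> - 1)"
            using bound[of "\<tau> * u"] u elim by (intro mult_right_mono) auto
          then show ?thesis using True by (simp add: abs_mult mult.commute)
        qed simp
      qed
    qed
  qed (use k in auto)
  also have "(\<integral>u. ?k u * L \<partial>lborel) = L / \<mu>" using k by simp
  finally have lim': "((\<lambda>\<tau>. (\<integral>u. ?k u * D (\<tau> * u) \<partial>lborel) / Gamma \<mu>) \<longlongrightarrow> L / \<mu> / Gamma \<mu>) at_top"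
    using Gamma_pos_nonzero[OF \<mu>] by (intro tendsto_divide tendsto_const) auto
  have L: "L / \<mu> / Gamma \<mu> = L / Gamma (\<mu> + 1)"
    using \<mu> by (simp add: Gamma_add_one_pos)
  have ev: "\<forall>\<^sub>F \<tau> in at_top. (\<integral>u. ?k u * D (\<tau> * u) \<partial>lborel) / Gamma \<mu> = RL_integral \<mu> D \<tau> / \<tau> powr \<mu>"
    using eventually_gt_at_top[of 0] by eventually_elim (simp add: scale)
  show ?thesis using Lim_transform_eventually[OF lim' ev] unfolding L .
qed

lemma borel_measurable_lebesgue_indicator_times [measurable (raw)]:
  fixes f :: "real \<Rightarrow> real"
  assumes "A \<in> sets borel" "f \<in> borel_measurable lebesgue"
  shows "(\<lambda>s. indicator A s * f s) \<in> borel_measurable lebesgue"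
  using assms by (intro borel_measurable_times borel_measurable_indicator) auto

text \<open>
  Fubini's theorem is applied on the product of Borel measures, but \<open>deriv x\<close> is controlled only almost
  everywhere on \<open>[0,\<infinity>)\<close>. The function \<open>g\<close> is a Borel version of it, which has the same fractional
  integrals and from which \<open>x\<close> is recovered by integration of order \<open>1\<close>.
\<close>

lemma AC_halfline_derivative:
  assumes x: "x \<in> AC_halfline"
  obtains g where "g \<in> borel_measurable borel" "\<And>T. set_integrable lborel {0..T} g"
    "\<And>\<mu>. RL_integral \<mu> (deriv x) = RL_integral \<mu> g"
    "\<And>\<tau>. 0 < \<tau> \<Longrightarrow> x \<tau> = x 0 + RL_integral 1 g \<tau>"
proof -
  have AC: "abs_continuous_on_interval 0 T x" if "0 < T" for T using x that by (simp add: AC_halfline_def)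
  define G where "G s = indicator {0..} s * deriv x s" for s
  have si: "set_integrable lebesgue {0..T} (deriv x)" for T
  proof -
    have "set_integrable lebesgue {0..max T 1} (deriv x)"
      using abs_continuous_FTC(1)[OF AC[of "max T 1"]] by simp
    then show ?thesis by (rule set_integrable_subset) auto
  qed
  have Geq: "indicator {0..T} s *\<^sub>R deriv x s = indicator {0..T} s * G s" for s T
    by (simp add: G_def indicator_def)
  have GT: "integrable lebesgue (\<lambda>s. indicator {0..T} s * G s)" for T
    using si[of T] unfolding set_integrable_def Geq .
  have Gm: "G \<in> borel_measurable lebesgue"
  proof (rule borel_measurable_LIMSEQ_real)
    show "(\<lambda>s. indicator {0..real n} s * G s) \<in> borel_measurable lebesgue" for n using GT[of "real n"] by auto
    fix s :: real
    obtain N where N: "s \<le> real N" using real_arch_simple by blast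
    have "\<forall>\<^sub>F n in sequentially. indicator {0..real n} s * G s = G s"
      using eventually_ge_at_top[of N] by eventually_elim (use N in \<open>auto simp: G_def indicator_def\<close>)
    then show "(\<lambda>n. indicator {0..real n} s * G s) \<longlonglongrightarrow> G s" by (rule tendsto_eventually)
  qed
  then obtain g where g[measurable]: "g \<in> borel_measurable borel" and gG: "AE s in lborel. G s = g s"
    using completion_ex_borel_measurable_real[of G lborel] by auto
  have gG': "AE s in lebesgue. G s = g s" using gG by (rule AE_completion)
  note Gm[measurable]
  have RL: "RL_integral \<mu> (deriv x) = RL_integral \<mu> g" for \<mu>
  proof
    fix \<tau>
    have "(LINT s:{0..\<tau>}|lebesgue. (\<tau> - s) powr (\<mu> - 1) * deriv x s) = (\<integral>s. indicator {0..\<tau>} s * (\<tau> - s) powr (\<mu> - 1) * G s \<partial>lebesgue)"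
      unfolding set_lebesgue_integral_def by (intro Bochner_Integration.integral_cong) (auto simp: G_def indicator_def)
    also have "\<dots> = (\<integral>s. indicator {0..\<tau>} s * (\<tau> - s) powr (\<mu> - 1) * g s \<partial>lebesgue)"
    proof (rule integral_cong_AE)
      have p: "(\<lambda>s. (\<tau> - s) powr (\<mu> - 1)) \<in> borel_measurable lebesgue" by (rule measurable_completion) simp
      have "g \<in> borel_measurable lebesgue" by (rule measurable_completion) simp
      with Gm show "(\<lambda>s. indicator {0..\<tau>} s * (\<tau> - s) powr (\<mu> - 1) * G s) \<in> borel_measurable lebesgue"
        "(\<lambda>s. indicator {0..\<tau>} s * (\<tau> - s) powr (\<mu> - 1) * g s) \<in> borel_measurable lebesgue"
        using p unfolding mult.assoc
        by (intro borel_measurable_lebesgue_indicator_times borel_measurable_times; simp)+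
      show "AE s in lebesgue. indicator {0..\<tau>} s * (\<tau> - s) powr (\<mu> - 1) * G s =
          indicator {0..\<tau>} s * (\<tau> - s) powr (\<mu> - 1) * g s"
        using gG' by eventually_elim simp
    qed
    also have "\<dots> = (LINT s:{0..\<tau>}|lebesgue. (\<tau> - s) powr (\<mu> - 1) * g s)"
      unfolding set_lebesgue_integral_def by (intro Bochner_Integration.integral_cong) auto
    finally show "RL_integral \<mu> (deriv x) \<tau> = RL_integral \<mu> g \<tau>" by (simp add: RL_integral_def)
  qed
  have gT: "integrable lebesgue (\<lambda>s. indicator {0..T} s * g s)" for T
    using GT[of T] by (rule integrable_cong_AE_imp) (use gG' in \<open>auto intro: measurable_completion\<close>)
  have gT': "set_integrable lborel {0..T} g" for T
    using gT[of T] by (simp add: set_integrable_def integrable_completion)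
  have "x \<tau> = x 0 + RL_integral 1 g \<tau>" if \<tau>: "0 < \<tau>" for \<tau>
  proof -
    have "x \<tau> - x 0 = integral {0..\<tau>} (deriv x)"
      using abs_continuous_FTC(2)[OF AC[OF \<tau>]] \<tau> by (simp add: integral_unique)
    also have "\<dots> = (LINT s:{0..\<tau>}|lebesgue. deriv x s)"
      using set_lebesgue_integral_eq_integral(2)[OF si[of \<tau>]] by simp
    also have "\<dots> = (LINT s:{0..\<tau>}|lebesgue. (\<tau> - s) powr (1 - 1) * deriv x s)"
      unfolding set_lebesgue_integral_def
    proof (rule integral_cong_AE)
      have "AE s in lebesgue. s \<noteq> \<tau>" by (intro AE_completion AE_lborel_singleton)
      then show "AE s in lebesgue. indicator {0..\<tau>} s *\<^sub>R deriv x s = indicator {0..\<tau>} s *\<^sub>R ((\<tau> - s) powr (1 - 1) * deriv x s)"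
        by eventually_elim auto
      show m: "(\<lambda>s. indicator {0..\<tau>} s *\<^sub>R deriv x s) \<in> borel_measurable lebesgue"
        using si[of \<tau>] by (auto simp: set_integrable_def)
      have "(\<lambda>s. (\<tau> - s) powr (1 - 1) * (indicator {0..\<tau>} s *\<^sub>R deriv x s)) \<in> borel_measurable lebesgue"
        by (intro borel_measurable_times m) (auto intro: measurable_completion)
      then show "(\<lambda>s. indicator {0..\<tau>} s *\<^sub>R ((\<tau> - s) powr (1 - 1) * deriv x s)) \<in> borel_measurable lebesgue"
        by (simp add: mult_ac)
    qed
    also have "\<dots> = RL_integral 1 (deriv x) \<tau>" by (simp add: RL_integral_def)
    finally show ?thesis by (simp add: RL)
  qed
  with g gT' RL that show ?thesis by blast
qed

section \<open>Weighted continuity and a linear integral inequality\<close>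

lemma C_weighted_continuous_on:
  assumes "h \<in> C_weighted \<eta>"
  shows "continuous_on {0<..} h"
proof -
  have c: "continuous_on {0<..} (\<lambda>\<tau>. \<tau> powr \<eta> * h \<tau>)" using assms by (simp add: C_weighted_def)
  have "continuous_on {0<..} (\<lambda>\<tau>::real. \<tau> powr (- \<eta>))" by (intro continuous_intros) auto
  from continuous_on_mult[OF this c]
  have "continuous_on {0<..} (\<lambda>\<tau>. \<tau> powr (- \<eta>) * (\<tau> powr \<eta> * h \<tau>))" .
  also have "?this \<longleftrightarrow> continuous_on {0<..} h"
    by (rule continuous_on_cong) (auto simp: powr_minus)
  finally show ?thesis .
qed

text \<open>
  The weighted function \<open>\<tau>\<^sup>\<eta> h \<tau>\<close> is bounded on \<open>(0,T]\<close>, by its limit at \<open>0\<close> and by compactness away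
  from \<open>0\<close>, and \<open>\<tau>\<^sup>-\<^sup>\<eta>\<close> is integrable there because \<open>\<eta> < 1\<close>.
\<close>

lemma C_weighted_set_integrable:
  assumes h: "h \<in> C_weighted \<eta>" and \<eta>: "\<eta> < 1"
  shows "set_integrable lborel {0<..T} h"
proof (cases "0 < T")
  case T: True
  define k where "k \<tau> = \<tau> powr \<eta> * h \<tau>" for \<tau>
  obtain L where "((\<lambda>\<tau>. \<tau> powr \<eta> * h \<tau>) \<longlongrightarrow> L) (at_right 0)"
    using h by (auto simp: C_weighted_def)
  then have "(k \<longlongrightarrow> L) (at_right 0)" by (simp add: k_def[abs_def])
  then have "\<forall>\<^sub>F \<tau> in at_right 0. dist (k \<tau>) L < 1" by (rule tendstoD) simp
  then obtain d where d: "d > 0" "\<And>\<tau>. 0 < \<tau> \<Longrightarrow> \<tau> < d \<Longrightarrow> dist (k \<tau>) L < 1"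
    by (auto simp: eventually_at_right_field)
  have "continuous_on {d..T} k"
    using h d(1) by (auto simp: C_weighted_def k_def[abs_def] elim!: continuous_on_subset)
  then have "bounded (k ` {d..T})" by (intro compact_imp_bounded compact_continuous_image) auto
  then obtain B where B: "\<forall>y\<in>k ` {d..T}. norm y \<le> B" unfolding bounded_iff by blast
  define C where "C = max B (\<bar>L\<bar> + 1)"
  have kC: "\<bar>k \<tau>\<bar> \<le> C" if \<tau>: "0 < \<tau>" "\<tau> \<le> T" for \<tau>
  proof (cases "\<tau> < d")
    case True
    then have "\<bar>k \<tau> - L\<bar> < 1" using d(2)[OF \<tau>(1)] by (simp add: dist_real_def)
    then show ?thesis by (simp add: C_def)
  next
    case False
    then have "\<bar>k \<tau>\<bar> \<le> B" using B \<tau> by auto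
    then show ?thesis by (simp add: C_def)
  qed
  have hC: "\<bar>h \<tau>\<bar> \<le> C * \<tau> powr (- \<eta>)" if \<tau>: "0 < \<tau>" "\<tau> \<le> T" for \<tau>
  proof -
    have "h \<tau> = \<tau> powr (- \<eta>) * k \<tau>" using \<tau> by (simp add: k_def powr_minus)
    then have "\<bar>h \<tau>\<bar> = \<tau> powr (- \<eta>) * \<bar>k \<tau>\<bar>" by (simp add: abs_mult)
    also have "\<dots> \<le> \<tau> powr (- \<eta>) * C" using kC[OF \<tau>] by (intro mult_left_mono) auto
    finally show ?thesis by (simp add: mult.commute)
  qed
  have "integrable lborel (\<lambda>s. indicator {0<..<T} s * ((T - s) powr (1 - 1) * (s - 0) powr (1 - \<eta> - 1)))"
    using has_bochner_integral_Beta_interval[of 1 "1 - \<eta>" 0 T] \<eta> T by (auto simp: has_bochner_integral_iff)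
  then have "integrable lborel (\<lambda>s. C * (indicator {0<..<T} s * ((T - s) powr (1 - 1) * (s - 0) powr (1 - \<eta> - 1))))"
    by (rule integrable_mult_right)
  then show ?thesis unfolding set_integrable_def
  proof (rule Bochner_Integration.integrable_bound)
    have "continuous_on {0<..T} h" using C_weighted_continuous_on[OF h] by (rule continuous_on_subset) auto
    then show "(\<lambda>s. indicator {0<..T} s *\<^sub>R h s) \<in> borel_measurable lborel"
      using borel_measurable_continuous_on_indicator[of "{0<..T}" h] by simp
    have "AE s in lborel. s \<noteq> T" by (rule AE_lborel_singleton)
    then show "AE s in lborel. norm (indicator {0<..T} s *\<^sub>R h s) \<le>
        norm (C * (indicator {0<..<T} s * ((T - s) powr (1 - 1) * (s - 0) powr (1 - \<eta> - 1))))"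
    proof eventually_elim
      case (elim s)
      show ?case
      proof (cases "s \<in> {0<..T}")
        case True
        then show ?thesis using hC[of s] elim by (simp add: order_trans[OF _ abs_ge_self])
      qed simp
    qed
  qed
qed (simp add: set_integrable_def)

lemma FTC_from_zero:
  fixes D :: "real \<Rightarrow> real"
  assumes D: "\<And>t. 0 < t \<Longrightarrow> (D has_real_derivative y t) (at t)"
    and y: "continuous_on {0<..} y" "set_integrable lborel {0<..\<tau>} y"
    and lim: "(D \<longlongrightarrow> b) (at_right 0)" and \<tau>: "0 < \<tau>"
  shows "D \<tau> = b + (LBINT s:{0<..\<tau>}. y s)"
proof -
  have "(LBINT s=ereal 0..ereal \<tau>. y s) = D \<tau> - b"
  proof (rule interval_integral_FTC_integrable)
    show "(D has_vector_derivative y t) (at t)" if "ereal 0 < ereal t" for t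
      using D[of t] that by (simp add: has_real_derivative_iff_has_vector_derivative)
    show "isCont y t" if "ereal 0 < ereal t" for t
      using y(1) that by (simp add: continuous_on_eq_continuous_at)
    show "set_integrable lborel (einterval (ereal 0) (ereal \<tau>)) y"
      by (rule set_integrable_subset[OF y(2)]) auto
    show "((D \<circ> real_of_ereal) \<longlongrightarrow> b) (at_right (ereal 0))"
      using lim by (simp add: ereal_tendsto_simps1)
    have "isCont D \<tau>" using D[OF \<tau>] by (rule DERIV_isCont)
    then show "((D \<circ> real_of_ereal) \<longlongrightarrow> D \<tau>) (at_left (ereal \<tau>))"
      by (simp add: ereal_tendsto_simps1 isCont_def filterlim_at_split)
  qed (use \<tau> in auto)
  then show ?thesis using \<tau> by (simp add: interval_integral_Ioc)
qed

text \<open>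
  A Gronwall argument for an integrable kernel. Let \<open>Y t\<close> be the integral of \<open>\<bar>y\<bar>\<close> up to \<open>t\<close>, and let the
  integral of \<open>K\<close> beyond \<open>T\<close> be less than \<open>1/2\<close>. Integrating the bound up to \<open>t \<ge> T\<close> and using that \<open>Y\<close> is nondecreasing,
  \<open>Y t \<le> \<integral>\<bar>P\<bar> + (c + Y T) \<integral>K + (c + Y t) / 2\<close>, which bounds \<open>Y t\<close> independently of \<open>t\<close>.
\<close>

lemma integrable_if_integral_inequality:
  fixes y P K :: "real \<Rightarrow> real"
  assumes y[measurable]: "y \<in> borel_measurable lebesgue"
    and loc: "\<And>T. integrable lebesgue (\<lambda>s. indicator {..T} s * y s)"
    and P: "integrable lebesgue P" and K: "integrable lebesgue K" and K0: "\<And>s. 0 \<le> K s"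
    and c: "0 \<le> c"
    and bound: "\<And>t. \<bar>y t\<bar> \<le> P t + K t * (c + (\<integral>s. indicator {..t} s * \<bar>y s\<bar> \<partial>lebesgue))"
  shows "integrable lebesgue y"
proof -
  define Y where "Y t = (\<integral>s. indicator {..t} s * \<bar>y s\<bar> \<partial>lebesgue)" for t
  have [measurable]: "K \<in> borel_measurable lebesgue" using K by auto
  have loc': "integrable lebesgue (\<lambda>s. indicator {..T} s * \<bar>y s\<bar>)" for T
    using integrable_abs[OF loc[of T]] by (simp add: abs_mult)
  have Y0: "0 \<le> Y t" for t unfolding Y_def by (intro integral_nonneg_AE) auto
  have Ymono: "Y s \<le> Y t" if "s \<le> t" for s t
    unfolding Y_def using that by (intro integral_mono loc') (auto simp: indicator_def)
  have "((\<lambda>t. \<integral>s. indicator {t<..} s * K s \<partial>lebesgue) \<longlongrightarrow> (\<integral>s. 0 \<partial>(lebesgue :: real measure))) at_top"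
  proof (rule integral_dominated_convergence_at_top[where w = K])
    show "AE s in lebesgue. ((\<lambda>t. indicator {t<..} s * K s) \<longlongrightarrow> 0) at_top"
    proof (rule AE_I2, rule tendsto_eventually)
      fix s :: real
      show "\<forall>\<^sub>F t in at_top. indicator {t<..} s * K s = 0"
        using eventually_ge_at_top[of s] by eventually_elim auto
    qed
    show "\<forall>\<^sub>F t in at_top. AE s in lebesgue. norm (indicator {t<..} s * K s) \<le> K s"
      using K0 by (intro always_eventually allI AE_I2) (auto simp: indicator_def)
  qed (use K in \<open>auto intro: borel_measurable_lebesgue_indicator_times\<close>)
  then have "\<forall>\<^sub>F t in at_top. (\<integral>s. indicator {t<..} s * K s \<partial>lebesgue) < 1 / 2"
    by (rule order_tendstoD) simp
  then obtain T where T: "(\<integral>s. indicator {T<..} s * K s \<partial>lebesgue) < 1 / 2"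
    by (auto simp: eventually_at_top_linorder)
  define B where "B = 2 * (\<integral>s. \<bar>P s\<bar> \<partial>lebesgue) + 2 * (c + Y T) * (\<integral>s. K s \<partial>lebesgue) + c"
  have YB: "Y t \<le> B" if t: "T \<le> t" for t
  proof -
    have iK: "integrable lebesgue (\<lambda>s. indicator {T<..} s * K s)"
    proof (rule Bochner_Integration.integrable_bound[OF K])
      show "AE s in lebesgue. norm (indicator {T<..} s * K s) \<le> norm (K s)"
        by (intro AE_I2) (auto simp: indicator_def)
    qed (auto intro: borel_measurable_lebesgue_indicator_times)
    have "Y t = (\<integral>s. indicator {..t} s * \<bar>y s\<bar> \<partial>lebesgue)" by (rule Y_def)
    also have "\<dots> \<le> (\<integral>s. \<bar>P s\<bar> + ((c + Y T) * K s + (c + Y t) * (indicator {T<..} s * K s)) \<partial>lebesgue)"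
    proof (rule integral_mono[OF loc'[of t]])
      show "integrable lebesgue (\<lambda>s. \<bar>P s\<bar> + ((c + Y T) * K s + (c + Y t) * (indicator {T<..} s * K s)))"
        using P K iK by (intro Bochner_Integration.integrable_add integrable_abs integrable_mult_right) auto
      fix s :: real
      have n: "0 \<le> (c + Y T) * K s" "0 \<le> (c + Y t) * K s" using c Y0 K0 by (auto intro!: mult_nonneg_nonneg add_nonneg_nonneg)
      consider "t < s" | "s \<le> T" | "T < s" "s \<le> t" by linarith
      then show "indicator {..t} s * \<bar>y s\<bar> \<le> \<bar>P s\<bar> + ((c + Y T) * K s + (c + Y t) * (indicator {T<..} s * K s))"
      proof cases
        case 1 then show ?thesis using n t by simp
      next
        case 2
        have "\<bar>y s\<bar> \<le> P s + K s * (c + Y s)" using bound[of s] by (simp add: Y_def)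
        also have "\<dots> \<le> \<bar>P s\<bar> + K s * (c + Y T)" using K0 Ymono[OF 2] by (intro add_mono mult_left_mono) auto
        finally show ?thesis using 2 t by (simp add: mult.commute)
      next
        case 3
        have "\<bar>y s\<bar> \<le> P s + K s * (c + Y s)" using bound[of s] by (simp add: Y_def)
        also have "\<dots> \<le> \<bar>P s\<bar> + K s * (c + Y t)" using K0 Ymono[OF 3(2)] by (intro add_mono mult_left_mono) auto
        finally show ?thesis using 3 n by (simp add: mult.commute)
      qed
    qed
    also have "\<dots> = (\<integral>s. \<bar>P s\<bar> \<partial>lebesgue) + ((c + Y T) * (\<integral>s. K s \<partial>lebesgue) + (c + Y t) * (\<integral>s. indicator {T<..} s * K s \<partial>lebesgue))"
      using P K iK by simp
    finally have 1: "Y t \<le> \<dots>" .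
    have 2: "(c + Y t) * (\<integral>s. indicator {T<..} s * K s \<partial>lebesgue) \<le> (c + Y t) * (1 / 2)"
      using T c Y0 by (intro mult_left_mono) auto
    have 3: "B = 2 * (\<integral>s. \<bar>P s\<bar> \<partial>lebesgue) + 2 * ((c + Y T) * (\<integral>s. K s \<partial>lebesgue)) + c"
      by (simp add: B_def)
    have lin: "v \<le> 2 * p + 2 * z + c" if "v \<le> p + (z + w)" "w \<le> (c + v) * (1 / 2)" for v p z w :: real
      using that by simp
    show ?thesis unfolding 3 by (rule lin[OF 1 2])
  qed
  show ?thesis
  proof (rule integrableI_bounded)
    let ?u = "\<lambda>n s. ennreal (indicator {..real n} s * \<bar>y s\<bar>)"
    have "(\<integral>\<^sup>+s. ennreal (norm (y s)) \<partial>lebesgue) = (\<integral>\<^sup>+s. (SUP n. ?u n s) \<partial>lebesgue)"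
    proof (rule nn_integral_cong)
      fix s :: real
      obtain n where n: "s \<le> real n" using real_arch_simple by blast
      have "(SUP n. ?u n s) = ennreal \<bar>y s\<bar>"
      proof (rule antisym)
        show "(SUP n. ?u n s) \<le> ennreal \<bar>y s\<bar>" by (intro SUP_least) (auto simp: indicator_def)
        show "ennreal \<bar>y s\<bar> \<le> (SUP n. ?u n s)" using n by (intro SUP_upper2[of n]) auto
      qed
      then show "ennreal (norm (y s)) = (SUP n. ?u n s)" by simp
    qed
    also have "\<dots> = (SUP n. \<integral>\<^sup>+s. ?u n s \<partial>lebesgue)"
    proof (rule nn_integral_monotone_convergence_SUP)
      show "incseq ?u" by (auto simp: incseq_def le_fun_def indicator_def intro!: ennreal_leI)
      show "?u n \<in> borel_measurable lebesgue" for n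
        by (intro measurable_compose[OF borel_measurable_lebesgue_indicator_times measurable_ennreal]) auto
    qed
    also have "\<dots> \<le> ennreal (max B (Y T))"
    proof (rule SUP_least)
      fix n
      have "(\<integral>\<^sup>+s. ?u n s \<partial>lebesgue) = ennreal (Y (real n))"
        unfolding Y_def by (rule nn_integral_eq_integral[OF loc']) auto
      also have "Y (real n) \<le> max B (Y T)"
        using YB[of "real n"] Ymono[of "real n" T] by (cases "T \<le> real n") auto
      finally show "(\<integral>\<^sup>+s. ?u n s \<partial>lebesgue) \<le> ennreal (max B (Y T))" by (simp add: ennreal_leI)
    qed
    finally show "(\<integral>\<^sup>+s. ennreal (norm (y s)) \<partial>lebesgue) < \<infinity>"
      by (simp add: order_le_less_trans[OF _ ennreal_less_top])
  qed simp
qed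

section \<open>Power asymptotics of solutions\<close>

lemma associated_function_nonneg:
  assumes "associated_function F N" "0 < t"
  shows "0 \<le> N t"
proof -
  have "0 \<le> F t 1 - F t 0" "F t 1 - F t 0 \<le> N t * (1 - 0)"
    using assms unfolding associated_function_def by (metis le_numeral_extra(3) zero_le_one)+
  then show ?thesis by simp
qed

text \<open>
  Monotonicity of \<open>F t\<close> raises \<open>u\<close> to \<open>r + h\<close>, and the Lipschitz constant \<open>N t\<close> pays for the step back
  to \<open>r\<close>.
\<close>

lemma associated_function_le:
  assumes F: "associated_function F N" and t: "0 < t" and u: "0 \<le> u" "u \<le> r + h" "0 \<le> r" "0 \<le> h"
  shows "F t u \<le> F t r + N t * h"
proof -
  have "F t u \<le> F t (r + h)" using F t u unfolding associated_function_def by (metis diff_ge_0_iff_ge)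
  moreover have "F t (r + h) - F t r \<le> N t * (r + h - r)"
    using F t u unfolding associated_function_def by (metis le_add_same_cancel1)
  ultimately show ?thesis by simp
qed

theorem theorem5p2:
  fixes \<alpha> \<beta> b1 b2 :: real
    and f :: "real \<Rightarrow> real \<Rightarrow> real \<Rightarrow> real"
    and F1 F2 :: "real \<Rightarrow> real \<Rightarrow> real"
    and N1 N2 :: "real \<Rightarrow> real"
  assumes "0 < \<beta>" and "\<beta> < \<alpha>" and "\<alpha> < 1"
    and "\<And>v w. v \<in> AC_halfline \<Longrightarrow> w \<in> AC_halfline \<Longrightarrow>
           (\<lambda>\<tau>. f \<tau> (v \<tau>) (w \<tau>)) \<in> C_weighted (1 - \<alpha>)"
    and "F1 \<in> class_M" and "F2 \<in> class_M"
    and "associated_function F1 N1" and "associated_function F2 N2"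
    and "\<And>\<tau> u v. \<tau> > 0 \<Longrightarrow> \<bar>f \<tau> u v\<bar> \<le> F1 \<tau> \<bar>u\<bar> + F2 \<tau> (\<tau> powr \<beta> * \<bar>v\<bar>)"
    and "set_integrable lebesgue {0<..} (\<lambda>s. s powr \<alpha> * N1 s)"
    and "set_integrable lebesgue {0<..} (\<lambda>s. s powr \<alpha> * N2 s)"
    and "set_integrable lebesgue {0<..} (\<lambda>s. F1 s \<bar>b1\<bar>)"
    and "set_integrable lebesgue {0<..} (\<lambda>s. F2 s \<bar>b1\<bar>)"
  shows "\<forall>x \<in> C_caputo \<alpha>.
           (\<forall>\<tau>>0. deriv (caputo \<alpha> x) \<tau> = f \<tau> (x \<tau>) (caputo \<beta> x \<tau>)) \<and>
           (caputo \<alpha> x \<longlongrightarrow> b2) (at_right 0) \<and> x 0 = b1 \<longrightarrow>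
           (\<exists>a. ((\<lambda>\<tau>. x \<tau> / \<tau> powr \<alpha>) \<longlongrightarrow> a) at_top)"
proof (intro ballI impI)
  fix x
  assume x: "x \<in> C_caputo \<alpha>"
    and sol: "(\<forall>\<tau>>0. deriv (caputo \<alpha> x) \<tau> = f \<tau> (x \<tau>) (caputo \<beta> x \<tau>)) \<and>
      (caputo \<alpha> x \<longlongrightarrow> b2) (at_right 0) \<and> x 0 = b1"
  note \<beta> = assms(1) and \<beta>\<alpha> = assms(2) and \<alpha>1 = assms(3) and F = assms(7,8) and growth = assms(9)
  have \<alpha>: "0 < \<alpha>" using \<beta> \<beta>\<alpha> by simp
  define D where "D = caputo \<alpha> x"
  define y where "y = deriv D"
  have xAC: "x \<in> AC_halfline" using x by (simp add: C_caputo_def)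
  have Dlim: "(D \<longlongrightarrow> b2) (at_right 0)" using sol by (simp add: D_def)
  have x0: "x 0 = b1" using sol by simp
  have yf: "y \<tau> = f \<tau> (x \<tau>) (caputo \<beta> x \<tau>)" if "0 < \<tau>" for \<tau>
    using sol that by (simp add: y_def D_def)
  have yC: "y \<in> C_weighted (1 - \<alpha>)" using x by (simp add: C_caputo_def y_def D_def)
  have Dder: "(D has_real_derivative y \<tau>) (at \<tau>)" if "0 < \<tau>" for \<tau>
    using x that by (simp add: C_caputo_def y_def D_def DERIV_deriv_iff_real_differentiable)
  obtain g where g[measurable]: "g \<in> borel_measurable borel" and gint: "\<And>T. set_integrable lborel {0..T} g"
    and RLg: "\<And>\<mu>. RL_integral \<mu> (deriv x) = RL_integral \<mu> g"
    and xg: "\<And>\<tau>. 0 < \<tau> \<Longrightarrow> x \<tau> = x 0 + RL_integral 1 g \<tau>"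
    using AC_halfline_derivative[OF xAC] by blast
  have Dg: "D = RL_integral (1 - \<alpha>) g" by (simp add: D_def caputo_def RLg)
  have Dm[measurable]: "D \<in> borel_measurable borel" unfolding Dg by measurable

  have xD: "x \<tau> = b1 + RL_integral \<alpha> D \<tau>" if \<tau>: "0 < \<tau>" for \<tau>
  proof -
    have "set_integrable lborel {0..\<tau>} (\<lambda>s. (\<tau> - s) powr (\<alpha> + (1 - \<alpha>) - 1) * g s)"
    proof (rule set_integrable_bound[OF gint[of \<tau>]])
      show "set_borel_measurable lborel {0..\<tau>} (\<lambda>s. (\<tau> - s) powr (\<alpha> + (1 - \<alpha>) - 1) * g s)"
        unfolding set_borel_measurable_def by measurable
      show "AE s in lborel. s \<in> {0..\<tau>} \<longrightarrow> norm ((\<tau> - s) powr (\<alpha> + (1 - \<alpha>) - 1) * g s) \<le> norm (g s)"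
        by (intro AE_I2) (simp add: abs_mult)
    qed
    from RL_integral_semigroup[OF g \<alpha> _ this] \<alpha>1 have "RL_integral \<alpha> D \<tau> = RL_integral 1 g \<tau>"
      by (simp add: Dg)
    then show ?thesis using xg[OF \<tau>] x0 by simp
  qed
  \<comment> \<open>Where the integral that defines the Caputo derivative of order \<open>\<beta>\<close> diverges, its value is \<open>0\<close>,
    and the estimate by fractional integrals of \<open>D\<close> persists.\<close>
  have cap: "caputo \<beta> x \<tau> = RL_integral (\<alpha> - \<beta>) D \<tau> \<or> caputo \<beta> x \<tau> = 0" for \<tau>
  proof (cases "set_integrable lborel {0..\<tau>} (\<lambda>s. (\<tau> - s) powr ((\<alpha> - \<beta>) + (1 - \<alpha>) - 1) * g s)")
    case True
    from RL_integral_semigroup[OF g _ _ this] \<beta>\<alpha> \<alpha>1 show ?thesis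
      by (simp add: Dg caputo_def RLg)
  next
    case False
    then have "RL_integral (1 - \<beta>) g \<tau> = 0"
      unfolding RL_integral_borel[OF g] set_integrable_def by (simp add: not_integrable_integral_eq)
    then show ?thesis by (simp add: caputo_def RLg)
  qed

  \<comment> \<open>Extension by \<open>0\<close> to the negative axis, so that \<open>{..t}\<close> can serve as domain of integration.\<close>
  define y0 where "y0 s = indicator {0<..} s * y s" for s
  have yc: "continuous_on {0<..} y" by (rule C_weighted_continuous_on[OF yC])
  have yi: "set_integrable lborel {0<..T} y" for T
    using C_weighted_set_integrable[OF yC] \<alpha> by simp
  have y0m: "y0 \<in> borel_measurable borel"
    using borel_measurable_continuous_on_indicator[of "{0<..}" y] yc by (simp add: y0_def[abs_def])
  have y0m': "y0 \<in> borel_measurable lebesgue" using y0m by (intro measurable_completion) simp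
  have y0eq: "indicator {..T} s * y0 s = indicator {0<..T} s *\<^sub>R y s" for T s
    by (auto simp: y0_def indicator_def)
  have y0i: "integrable lborel (\<lambda>s. indicator {..T} s * y0 s)" for T
    using yi[of T] unfolding y0eq set_integrable_def .
  have y0i': "integrable lebesgue (\<lambda>s. indicator {..T} s * y0 s)" for T
    using y0i[of T] y0m by (subst integrable_completion) auto
  have DI: "D \<tau> = b2 + (\<integral>s. indicator {..\<tau>} s * y0 s \<partial>lborel)" if "0 < \<tau>" for \<tau>
    using FTC_from_zero[OF Dder yc yi Dlim that] by (simp add: y0eq set_lebesgue_integral_def)
  define W where "W t = \<bar>b2\<bar> + (\<integral>s. indicator {..t} s * \<bar>y0 s\<bar> \<partial>lebesgue)" for t
  have absi: "integrable lebesgue (\<lambda>s. indicator {..T} s * \<bar>y0 s\<bar>)" for T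
    using integrable_abs[OF y0i'[of T]] by (simp add: abs_mult)
  have W0: "0 \<le> W t" for t unfolding W_def by (intro add_nonneg_nonneg integral_nonneg_AE) auto
  have Wmono: "W s \<le> W t" if "s \<le> t" for s t
    unfolding W_def using that by (intro add_left_mono integral_mono absi) (auto simp: indicator_def)
  have DW: "\<bar>D t\<bar> \<le> W t" if "0 < t" for t
  proof -
    have "\<bar>D t\<bar> \<le> \<bar>b2\<bar> + \<bar>\<integral>s. indicator {..t} s * y0 s \<partial>lborel\<bar>" using DI[OF that] by simp
    also have "(\<integral>s. indicator {..t} s * y0 s \<partial>lborel) = (\<integral>s. indicator {..t} s * y0 s \<partial>lebesgue)"
      using y0m by (subst integral_completion) auto
    also have "\<bar>\<dots>\<bar> \<le> (\<integral>s. \<bar>indicator {..t} s * y0 s\<bar> \<partial>lebesgue)" by (rule integral_abs_bound)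
    finally show ?thesis by (simp add: W_def abs_mult)
  qed
  have DW': "\<bar>D s\<bar> \<le> W t" if "0 < s" "s \<le> t" for s t
    using DW[OF that(1)] Wmono[OF that(2)] by simp

  \<comment> \<open>The constants with which \<open>RL_integral\<close> of orders \<open>\<alpha>\<close> and \<open>\<alpha> - \<beta>\<close> acts on constants.\<close>
  define c1 c2 where "c1 = 1 / Gamma (\<alpha> + 1)" and "c2 = 1 / Gamma (\<alpha> - \<beta> + 1)"
  have c: "0 \<le> c1" "0 \<le> c2" using \<alpha> \<beta>\<alpha> by (auto simp: c1_def c2_def intro!: less_imp_le Gamma_real_pos)
  define P where "P s = indicator {0<..} s * F1 s \<bar>b1\<bar> + indicator {0<..} s * F2 s \<bar>b1\<bar>" for s
  define K where "K s = c1 * (indicator {0<..} s * (s powr \<alpha> * N1 s)) + c2 * (indicator {0<..} s * (s powr \<alpha> * N2 s))" for s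
  have "integrable lebesgue y0"
  proof (rule integrable_if_integral_inequality[OF y0m' y0i'])
    show "integrable lebesgue P"
      using assms(12,13) unfolding P_def[abs_def] set_integrable_def by (intro Bochner_Integration.integrable_add) auto
    show "integrable lebesgue K"
      using assms(10,11) unfolding K_def[abs_def] set_integrable_def
      by (intro Bochner_Integration.integrable_add integrable_mult_right) auto
    show "0 \<le> K s" for s
      using c associated_function_nonneg[OF F(1)] associated_function_nonneg[OF F(2)]
      by (auto simp: K_def indicator_def)
    show "\<bar>y0 t\<bar> \<le> P t + K t * (\<bar>b2\<bar> + (\<integral>s. indicator {..t} s * \<bar>y0 s\<bar> \<partial>lebesgue))" for t
    proof (cases "0 < t")
      case t: True
      have "\<bar>x t\<bar> \<le> \<bar>b1\<bar> + \<bar>RL_integral \<alpha> D t\<bar>" using xD[OF t] by simp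
      also have "\<bar>RL_integral \<alpha> D t\<bar> \<le> W t * t powr \<alpha> / Gamma (\<alpha> + 1)"
        by (rule RL_integral_abs_le[OF \<alpha> t W0 DW'])
      finally have xt: "\<bar>x t\<bar> \<le> \<bar>b1\<bar> + c1 * (t powr \<alpha> * W t)" by (simp add: c1_def mult.commute)
      have "\<bar>caputo \<beta> x t\<bar> \<le> \<bar>RL_integral (\<alpha> - \<beta>) D t\<bar>" using cap[of t] by auto
      also have "\<dots> \<le> W t * t powr (\<alpha> - \<beta>) / Gamma (\<alpha> - \<beta> + 1)"
        by (rule RL_integral_abs_le[OF _ t W0 DW']) (use \<beta>\<alpha> in simp)
      finally have "t powr \<beta> * \<bar>caputo \<beta> x t\<bar> \<le> t powr \<beta> * (W t * t powr (\<alpha> - \<beta>) / Gamma (\<alpha> - \<beta> + 1))"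
        by (intro mult_left_mono) auto
      also have "\<dots> = c2 * ((t powr \<beta> * t powr (\<alpha> - \<beta>)) * W t)" by (simp add: c2_def)
      also have "t powr \<beta> * t powr (\<alpha> - \<beta>) = t powr \<alpha>" by (simp add: powr_add[symmetric])
      finally have ct: "t powr \<beta> * \<bar>caputo \<beta> x t\<bar> \<le> \<bar>b1\<bar> + c2 * (t powr \<alpha> * W t)" by simp
      have "\<bar>y t\<bar> \<le> F1 t \<bar>x t\<bar> + F2 t (t powr \<beta> * \<bar>caputo \<beta> x t\<bar>)"
        unfolding yf[OF t] by (rule growth[OF t])
      also have "\<dots> \<le> (F1 t \<bar>b1\<bar> + N1 t * (c1 * (t powr \<alpha> * W t))) + (F2 t \<bar>b1\<bar> + N2 t * (c2 * (t powr \<alpha> * W t)))"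
        using c W0 by (intro add_mono associated_function_le[OF F(1) t _ xt] associated_function_le[OF F(2) t _ ct]) auto
      also have "\<dots> = P t + K t * W t" using t by (simp add: P_def K_def algebra_simps)
      finally show ?thesis using t by (simp add: y0_def W_def)
    next
      case False
      then show ?thesis by (simp add: y0_def P_def K_def)
    qed
  qed simp
  then have y0int: "integrable lborel y0" using y0m by (simp add: integrable_completion)

  have "((\<lambda>t. \<integral>s. indicator {..t} s * y0 s \<partial>lborel) \<longlongrightarrow> (\<integral>s. y0 s \<partial>lborel)) at_top"
    using tendsto_integral_at_top[of lborel y0] y0int by simp
  then have "((\<lambda>t. b2 + (\<integral>s. indicator {..t} s * y0 s \<partial>lborel)) \<longlongrightarrow> b2 + (\<integral>s. y0 s \<partial>lborel)) at_top"
    by (intro tendsto_add tendsto_const)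
  moreover have "\<forall>\<^sub>F t in at_top. b2 + (\<integral>s. indicator {..t} s * y0 s \<partial>lborel) = D t"
    using eventually_gt_at_top[of 0] by eventually_elim (simp add: DI)
  ultimately have Dinf: "(D \<longlongrightarrow> b2 + (\<integral>s. y0 s \<partial>lborel)) at_top"
    by (rule Lim_transform_eventually)
  have Dbd: "\<bar>D s\<bar> \<le> \<bar>b2\<bar> + (\<integral>s. \<bar>y0 s\<bar> \<partial>lebesgue)" if "0 < s" for s
  proof -
    have "W s \<le> \<bar>b2\<bar> + (\<integral>s. \<bar>y0 s\<bar> \<partial>lebesgue)"
      unfolding W_def using \<open>integrable lebesgue y0\<close>
      by (intro add_left_mono integral_mono absi integrable_abs) (auto simp: indicator_def)
    then show ?thesis using DW[OF that] by simp
  qed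
  let ?a = "(b2 + (\<integral>s. y0 s \<partial>lborel)) / Gamma (\<alpha> + 1)"
  have "((\<lambda>\<tau>. b1 / \<tau> powr \<alpha> + RL_integral \<alpha> D \<tau> / \<tau> powr \<alpha>) \<longlongrightarrow> 0 + ?a) at_top"
  proof (rule tendsto_add)
    show "((\<lambda>\<tau>. b1 / \<tau> powr \<alpha>) \<longlongrightarrow> 0) at_top"
      using tendsto_mult[OF tendsto_const tendsto_neg_powr[OF _ filterlim_ident], of "- \<alpha>" b1] \<alpha>
      by (simp add: powr_minus divide_inverse)
    show "((\<lambda>\<tau>. RL_integral \<alpha> D \<tau> / \<tau> powr \<alpha>) \<longlongrightarrow> ?a) at_top"
      by (rule RL_integral_asymptotic[OF \<alpha> Dm Dbd Dinf])
  qed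
  moreover have "\<forall>\<^sub>F \<tau> in at_top. b1 / \<tau> powr \<alpha> + RL_integral \<alpha> D \<tau> / \<tau> powr \<alpha> = x \<tau> / \<tau> powr \<alpha>"
    using eventually_gt_at_top[of 0] by eventually_elim (simp add: xD add_divide_distrib)
  ultimately have "((\<lambda>\<tau>. x \<tau> / \<tau> powr \<alpha>) \<longlongrightarrow> 0 + ?a) at_top"
    by (rule Lim_transform_eventually)
  then show "\<exists>a. ((\<lambda>\<tau>. x \<tau> / \<tau> powr \<alpha>) \<longlongrightarrow> a) at_top" by blast
qed

end
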